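(* Let $M$ be an orientable surface immersed in $(\mathbb{R}^3,\|\cdot\|)$ with Birkhoff-Gauss map $\eta:M\to\partial B$ and Minkowski Gaussian curvature $K$. Let $p\in M$ be a point with $K(p)\neq 0$, and let $U\subseteq M$ be a connected neighborhood of $p$ on which the sign of $K$ does not change. Then $$K(p)=\lim_{D\to p}\frac{\lambda_{\partial B}(\eta(D))}{\lambda_M(D)},$$ where $D\subseteq U$ ranges over open neighborhoods of $p$ shrinking to $p$, and $\eta(D)\subseteq\partial B$ is the image of $D$ under the Birkhoff-Gauss map.
   Context: $\|\cdot\|$ is a smooth and strictly convex norm on $\mathbb{R}^3$ with unit ball $B=\{x:\|x\|\le 1\}$ and unit sphere $\partial B=\{x:\|x\|=1\}$; the usual (Euclidean) Gaussian curvature of the surface $\partial B$ is assumed to vanish nowhere. A vector $v$ is Birkhoff orthogonal to a plane $P\subseteq\mathbb{R}^3$ (through the origin) if $\|v\|\le\|v+tw\|$ for all $w\in P$, $t\in\mathbb{R}$. For an immersion $f:M\to\mathbb{R}^3$ of an orientable smooth surface, $T_pM$ is identified with $f_*(T_pM)\subset\mathbb{R}^3$. The Birkhoff-Gauss map $\eta:M\to\partial B$ is a smooth map such that $\eta(p)$ is Birkhoff orthogonal to $T_pM$ for each $p$. Since $T_{\eta(p)}\partial B=T_pM$ as linear planes, $d\eta_p$ is an endomorphism of $T_pM$; it is diagonalizable over $\mathbb{R}$. The Minkowski Gaussian curvature is $K(p)=\det(d\eta_p)$. The area element on $M$ is $\omega(X,Y)=\det(X,Y,\eta)$ ($\det$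 the usual determinant of $\mathbb{R}^3$, $M$ oriented so that $\omega$ is positive), and the area of an open bounded subset $D\subseteq M$ is $\lambda_M(D)=\int_D\omega$. For $\partial B$ itself the Birkhoff-Gauss map is the identity (outward normal), so its area element at $q\in\partial B$ is $\det(X,Y,q)$, which defines $\lambda_{\partial B}$. Sign convention: in the quotient, the area $\lambda_{\partial B}(\eta(D))$ is taken with negative sign when $K<0$ on $D$. The limit $D\to p$ means: for every $\varepsilon>0$ there is a neighborhood $W\subseteq U$ of $p$ such that the quotient differs from $K(p)$ by less than $\varepsilon$ for all open $D$ with $p\in D\subseteq W$. *)

theory Defs
  imports "HOL-Analysis.Analysis"
begin

section \<open>Smooth maps on open subsets of Euclidean spaces\<close>

text \<open>\<open>C_on k f S\<close>: on the open set \<open>S\<close>, \<open>f\<close> is \<open>k\<close> times continuously differentiable. The class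
  is defined by recursion through all directional derivatives.\<close>

fun C_on :: "nat \<Rightarrow> ('a::euclidean_space \<Rightarrow> 'b::euclidean_space) \<Rightarrow> 'a set \<Rightarrow> bool" where
  "C_on 0 f S \<longleftrightarrow> continuous_on S f"
| "C_on (Suc k) f S \<longleftrightarrow>
     (\<forall>u\<in>S. f differentiable (at u)) \<and> (\<forall>h. C_on k (\<lambda>u. frechet_derivative f (at u) h) S)"

definition smooth_on :: "('a::euclidean_space \<Rightarrow> 'b::euclidean_space) \<Rightarrow> 'a set \<Rightarrow> bool" where
  "smooth_on f S \<longleftrightarrow> (\<forall>k. C_on k f S)"


section \<open>Norms on three-space and Birkhoff orthogonality\<close>

definition is_norm :: "(real^3 \<Rightarrow> real) \<Rightarrow> bool" where
  "is_norm N \<longleftrightarrow>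
     (\<forall>v. 0 \<le> N v) \<and> (\<forall>v. N v = 0 \<longleftrightarrow> v = 0) \<and>
     (\<forall>c v. N (c *\<^sub>R v) = \<bar>c\<bar> * N v) \<and> (\<forall>v w. N (v + w) \<le> N v + N w)"

definition smooth_norm :: "(real^3 \<Rightarrow> real) \<Rightarrow> bool" where
  "smooth_norm N \<longleftrightarrow> smooth_on N (- {0})"

definition unit_sphere :: "(real^3 \<Rightarrow> real) \<Rightarrow> (real^3) set" where
  "unit_sphere N = {v. N v = 1}"

definition strictly_convex_norm :: "(real^3 \<Rightarrow> real) \<Rightarrow> bool" where
  "strictly_convex_norm N \<longleftrightarrow>
     (\<forall>v\<in>unit_sphere N. \<forall>w\<in>unit_sphere N. v \<noteq> w \<longrightarrow> (\<forall>z\<in>open_segment v w. N z < 1))"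

definition birkhoff_orthogonal :: "(real^3 \<Rightarrow> real) \<Rightarrow> real^3 \<Rightarrow> (real^3) set \<Rightarrow> bool" where
  "birkhoff_orthogonal N v P \<longleftrightarrow> (\<forall>w\<in>P. \<forall>t. N v \<le> N (v + t *\<^sub>R w))"


section \<open>Smooth surfaces and immersions\<close>

text \<open>A local parametrization of a surface is a pair \<open>(\<Omega>, x)\<close> of an open set in the plane and a map
  \<open>x\<close>, which only matters on \<open>\<Omega>\<close>; it is the inverse of a chart. An atlas is a set of these. Atlases
  need not be maximal.\<close>

type_synonym 'a param = "(real^2) set \<times> (real^2 \<Rightarrow> 'a)"

definition second_countable_space :: "'a topology \<Rightarrow> bool" where
  "second_countable_space X \<longleftrightarrow>
     (\<exists>\<B>. countable \<B> \<and> (\<forall>B\<in>\<B>. openin X B) \<and>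
          (\<forall>V p. openin X V \<and> p \<in> V \<longrightarrow> (\<exists>B\<in>\<B>. p \<in> B \<and> B \<subseteq> V)))"

definition overlap :: "'a param \<Rightarrow> 'a param \<Rightarrow> (real^2) set" where
  "overlap c d = {u \<in> fst c. snd c u \<in> snd d ` fst d}"

definition transition :: "'a param \<Rightarrow> 'a param \<Rightarrow> real^2 \<Rightarrow> real^2" where
  "transition c d = inv_into (fst d) (snd d) \<circ> snd c"

definition smooth_surface :: "'a topology \<Rightarrow> 'a param set \<Rightarrow> bool" where
  "smooth_surface X A \<longleftrightarrow>
     Hausdorff_space X \<and> second_countable_space X \<and>
     (\<forall>(\<Omega>, x)\<in>A. open \<Omega> \<and> embedding_map (top_of_set \<Omega>) X x \<and> openin X (x ` \<Omega>)) \<and>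
     (\<Union>(\<Omega>, x)\<in>A. x ` \<Omega>) = topspace X \<and>
     (\<forall>c\<in>A. \<forall>d\<in>A. smooth_on (transition c d) (overlap c d))"

text \<open>Orientable: some atlas \<open>A'\<close> of the same smooth structure has transition maps with positive
  Jacobian determinant.\<close>

definition orientable_surface :: "'a topology \<Rightarrow> 'a param set \<Rightarrow> bool" where
  "orientable_surface X A \<longleftrightarrow>
     smooth_surface X A \<and>
     (\<exists>A'. smooth_surface X A' \<and> smooth_surface X (A \<union> A') \<and>
           (\<forall>c\<in>A'. \<forall>d\<in>A'. \<forall>u\<in>overlap c d.
              det (matrix (frechet_derivative (transition c d) (at u))) > 0))"

definition smooth_map :: "'a param set \<Rightarrow> ('a \<Rightarrow> real^3) \<Rightarrow> bool" where
  "smooth_map A g \<longleftrightarrow> (\<forall>(\<Omega>, x)\<in>A. smooth_on (g \<circ> x) \<Omega>)"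

definition immersion :: "'a param set \<Rightarrow> ('a \<Rightarrow> real^3) \<Rightarrow> bool" where
  "immersion A f \<longleftrightarrow>
     smooth_map A f \<and> (\<forall>(\<Omega>, x)\<in>A. \<forall>u\<in>\<Omega>. inj (frechet_derivative (f \<circ> x) (at u)))"

text \<open>The tangent plane at \<open>p\<close>, identified with its image in three-space under the differential of the
  immersion \<open>f\<close>. All parametrizations around \<open>p\<close> give the same plane, so the union is that plane.\<close>

definition tangent_plane :: "'a param set \<Rightarrow> ('a \<Rightarrow> real^3) \<Rightarrow> 'a \<Rightarrow> (real^3) set" where
  "tangent_plane A f p =
     (\<Union>(\<Omega>, x)\<in>A. \<Union>u\<in>{u \<in> \<Omega>. x u = p}. range (frechet_derivative (f \<circ> x) (at u)))"

text \<open>The differential at \<open>p\<close> of a map \<open>g\<close> on the surface, as a map on that tangent plane: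
  the image under \<open>d(f \<circ> x)\<close> of a vector \<open>h\<close> is sent to its image under \<open>d(g \<circ> x)\<close>.\<close>

definition surface_differential ::
  "'a param set \<Rightarrow> ('a \<Rightarrow> real^3) \<Rightarrow> ('a \<Rightarrow> real^3) \<Rightarrow> 'a \<Rightarrow> real^3 \<Rightarrow> real^3" where
  "surface_differential A f g p w =
     (THE z. \<exists>(\<Omega>, x)\<in>A. \<exists>u\<in>\<Omega>. \<exists>h. x u = p \<and>
        w = frechet_derivative (f \<circ> x) (at u) h \<and> z = frechet_derivative (g \<circ> x) (at u) h)"

text \<open>The determinant of an endomorphism \<open>L\<close> of a two-dimensional subspace \<open>P\<close>: the determinant of
  the matrix of \<open>L\<close> in any basis \<open>b\<close> of \<open>P\<close>.\<close>

definition plane_det :: "(real^3) set \<Rightarrow> (real^3 \<Rightarrow> real^3) \<Rightarrow> real" where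
  "plane_det P L =
     (THE d. \<exists>(b :: 2 \<Rightarrow> real^3) (m :: real^2^2).
        inj b \<and> independent (range b) \<and> span (range b) = P \<and>
        (\<forall>j. L (b j) = (\<Sum>i\<in>UNIV. m $ i $ j *\<^sub>R b i)) \<and> d = det m)"

text \<open>The curvature associated with a normal map \<open>\<nu>\<close>. It is the usual Gaussian curvature if \<open>\<nu>\<close> is
  a Euclidean Gauss map and the Minkowski Gaussian curvature if \<open>\<nu>\<close> is a Birkhoff-Gauss map.\<close>

definition normal_map_curvature ::
  "'a param set \<Rightarrow> ('a \<Rightarrow> real^3) \<Rightarrow> ('a \<Rightarrow> real^3) \<Rightarrow> 'a \<Rightarrow> real" where
  "normal_map_curvature A f \<nu> p = plane_det (tangent_plane A f p) (surface_differential A f \<nu> p)"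

definition euclidean_gauss_map ::
  "'a topology \<Rightarrow> 'a param set \<Rightarrow> ('a \<Rightarrow> real^3) \<Rightarrow> ('a \<Rightarrow> real^3) \<Rightarrow> bool" where
  "euclidean_gauss_map X A f \<nu> \<longleftrightarrow>
     smooth_map A \<nu> \<and>
     (\<forall>p\<in>topspace X. norm (\<nu> p) = 1 \<and> (\<forall>w\<in>tangent_plane A f p. \<nu> p \<bullet> w = 0))"

definition birkhoff_gauss_map ::
  "(real^3 \<Rightarrow> real) \<Rightarrow> 'a topology \<Rightarrow> 'a param set \<Rightarrow> ('a \<Rightarrow> real^3) \<Rightarrow> ('a \<Rightarrow> real^3) \<Rightarrow> bool" where
  "birkhoff_gauss_map N X A f \<eta> \<longleftrightarrow>
     smooth_map A \<eta> \<and>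
     (\<forall>p\<in>topspace X. \<eta> p \<in> unit_sphere N \<and> birkhoff_orthogonal N (\<eta> p) (tangent_plane A f p))"


section \<open>The unit sphere as a surface\<close>

text \<open>The regular parametrizations of a subset \<open>S\<close> of three-space; for an embedded surface they form its
  maximal atlas.\<close>

definition regular_params :: "(real^3) set \<Rightarrow> (real^3) param set" where
  "regular_params S =
     {(\<Omega>, x). open \<Omega> \<and> smooth_on x \<Omega> \<and> (\<forall>u\<in>\<Omega>. inj (frechet_derivative x (at u))) \<and>
        embedding_map (top_of_set \<Omega>) (top_of_set S) x \<and> openin (top_of_set S) (x ` \<Omega>)}"

text \<open>The Euclidean Gauss map of an embedded sphere is unique up to sign and the Gaussian curvature does
  not depend on that sign, so it does not matter which \<open>\<nu>\<close> is taken.\<close>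

definition nowhere_zero_gauss_curvature :: "(real^3) set \<Rightarrow> bool" where
  "nowhere_zero_gauss_curvature S \<longleftrightarrow>
     (\<exists>\<nu>. euclidean_gauss_map (top_of_set S) (regular_params S) id \<nu> \<and>
          (\<forall>q\<in>S. normal_map_curvature (regular_params S) id \<nu> q \<noteq> 0))"


section \<open>Area\<close>

text \<open>The area element \<open>\<omega>(X, Y) = det (X, Y, \<eta>)\<close> in a parametrization \<open>x\<close>, evaluated at the two
  coordinate vector fields.\<close>

definition area_density ::
  "('a \<Rightarrow> real^3) \<Rightarrow> ('a \<Rightarrow> real^3) \<Rightarrow> (real^2 \<Rightarrow> 'a) \<Rightarrow> real^2 \<Rightarrow> real" where
  "area_density f \<eta> x u =
     det (vector [frechet_derivative (f \<circ> x) (at u) (axis 1 1),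
                  frechet_derivative (f \<circ> x) (at u) (axis 2 1),
                  \<eta> (x u)] :: real^3^3)"

text \<open>The integral of \<open>\<omega>\<close> over \<open>D\<close>: cut \<open>D\<close> into countably many disjoint Borel pieces, each inside the
  image of one parametrization, and add up the integrals over the parameter domains. The absolute value
  accounts for the orientation making \<open>\<omega>\<close> positive, as the parametrizations in \<open>A\<close> may have
  either orientation.\<close>

definition has_area ::
  "'a param set \<Rightarrow> ('a \<Rightarrow> real^3) \<Rightarrow> ('a \<Rightarrow> real^3) \<Rightarrow> 'a set \<Rightarrow> ennreal \<Rightarrow> bool" where
  "has_area A f \<eta> D a \<longleftrightarrow>
     (\<exists>\<Omega> x C. (\<forall>i::nat. (\<Omega> i, x i) \<in> A \<and> C i \<in> sets borel \<and> C i \<subseteq> \<Omega> i) \<and>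
        disjoint_family (\<lambda>i. x i ` C i) \<and> (\<Union>i. x i ` C i) = D \<and>
        a = (\<Sum>i. \<integral>\<^sup>+ u \<in> C i. ennreal \<bar>area_density f \<eta> (x i) u\<bar> \<partial>lborel))"

text \<open>An infinite area becomes \<open>0\<close> here. A quotient of areas with such a denominator is then \<open>0\<close>,
  so convergence of these quotients to a nonzero limit includes finiteness of the areas of all small
  enough open sets.\<close>

definition surface_area ::
  "'a param set \<Rightarrow> ('a \<Rightarrow> real^3) \<Rightarrow> ('a \<Rightarrow> real^3) \<Rightarrow> 'a set \<Rightarrow> real" where
  "surface_area A f \<eta> D = enn2real (THE a. has_area A f \<eta> D a)"

text \<open>On the unit sphere the immersion is the inclusion, and the Birkhoff-Gauss map is the identity.\<close>

definition sphere_area :: "(real^3 \<Rightarrow> real) \<Rightarrow> (real^3) set \<Rightarrow> real" where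
  "sphere_area N E = surface_area (regular_params (unit_sphere N)) id id E"

definition signed_image_area ::
  "(real^3 \<Rightarrow> real) \<Rightarrow> 'a param set \<Rightarrow> ('a \<Rightarrow> real^3) \<Rightarrow> ('a \<Rightarrow> real^3) \<Rightarrow> 'a set \<Rightarrow> real" where
  "signed_image_area N A f \<eta> D =
     (if \<forall>q\<in>D. normal_map_curvature A f \<eta> q < 0 then - sphere_area N (\<eta> ` D)
      else sphere_area N (\<eta> ` D))"

definition neighborhood_of :: "'a topology \<Rightarrow> 'a \<Rightarrow> 'a set \<Rightarrow> bool" where
  "neighborhood_of X p W \<longleftrightarrow> W \<subseteq> topspace X \<and> (\<exists>V. openin X V \<and> p \<in> V \<and> V \<subseteq> W)"

end

theory Submission
  imports Defs
begin

text \<open>In a parametrization \<open>x\<close> around \<open>p\<close>, the endomorphism \<open>d\<eta>\<close> of the tangent plane multiplies the area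
  element: \<open>det (d(\<eta> \<circ> x) e\<^sub>1, d(\<eta> \<circ> x) e\<^sub>2, \<eta>) = K det (d(f \<circ> x) e\<^sub>1, d(f \<circ> x) e\<^sub>2, \<eta>)\<close>. Where \<open>K \<noteq> 0\<close>, the
  map \<open>\<eta> \<circ> x\<close> is locally a regular parametrization of the unit sphere, so for small \<open>D\<close> both areas are
  integrals over the same parameter domain, with densities whose ratio is \<open>\<bar>K\<bar>\<close>. Continuity of \<open>K\<close> at \<open>p\<close> gives
  the limit. By the change of variables formula, the areas do not depend on how \<open>D\<close> is cut into
  parametrized pieces.\<close>

section \<open>Three-dimensional determinants\<close>

text \<open>Areas are definite descriptions over all countable Borel decompositions and all
  parametrizations of an atlas, so a formula in one parametrization requires transporting every
  foreign piece into it. On the sphere the atlas consists of all regular parametrizations, and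
  smoothness of their transition maps is not part of its definition. Only transitions into the one
  chart \<eta> \<circ> x have to be shown differentiable, because all pieces are transported into
  that chart. That \<eta> \<circ> x is a chart also makes \<eta> injective near p, so \<eta>(D) is
  covered once and its area is the integral of the pulled-back density. The norm and the curvature
  meet in one linear form, the derivative of \<open>N\<close> at \<eta>: it shows that \<eta> is
  transverse to the tangent plane and that d\<eta> maps this plane into itself.\<close>

lemma linear_real2:
  fixes L :: "real^2 \<Rightarrow> 'b::real_vector"
  assumes "linear L"
  shows "L h = h $ 1 *\<^sub>R L (axis 1 1) + h $ 2 *\<^sub>R L (axis 2 1)"
proof -
  have "h = h $ 1 *\<^sub>R axis 1 1 + h $ 2 *\<^sub>R (axis 2 1 :: real^2)"
    by (simp add: vec_eq_iff forall_2 axis_def)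
  then have "L h = L (h $ 1 *\<^sub>R axis 1 1 + h $ 2 *\<^sub>R axis 2 1)"
    by simp
  then show ?thesis
    by (simp add: linear_add[OF assms] linear_scale[OF assms])
qed

abbreviation det3 :: "real^3 \<Rightarrow> real^3 \<Rightarrow> real^3 \<Rightarrow> real" where
  "det3 a b c \<equiv> det (vector [a, b, c] :: real^3^3)"

lemma det3_combination:
  "det3 (s *\<^sub>R a + t *\<^sub>R b) (s' *\<^sub>R a + t' *\<^sub>R b) c = (s * t' - s' * t) * det3 a b c"
  by (simp add: det_3 algebra_simps)

text \<open>This is the source of the Jacobian in a change of parameters: the columns of
  \<open>matrix T\<close> are the coordinates of \<open>T\<close> on the two axes, and the form is
  alternating in its first two arguments.\<close>

lemma det3_linear_comp:
  fixes L :: "real^2 \<Rightarrow> real^3" and T :: "real^2 \<Rightarrow> real^2"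
  assumes "linear L"
  shows "det3 (L (T (axis 1 1))) (L (T (axis 2 1))) c =
    det (matrix T) * det3 (L (axis 1 1)) (L (axis 2 1)) c"
  by (simp add: linear_real2[OF assms, of "T _"] det3_combination det_2 matrix_def)

text \<open>The transpose has \<open>a\<close>, \<open>b\<close>, \<open>c\<close> as columns, so
  its values are their linear combinations. The companion criterion by independence comes from the
  kernel of the same matrix.\<close>

lemma det3_nonzero_iff_surj:
  "det3 a b c \<noteq> 0 \<longleftrightarrow> (\<forall>w. \<exists>r s t. w = r *\<^sub>R a + s *\<^sub>R b + t *\<^sub>R c)"
proof -
  let ?A = "vector [a, b, c] :: real^3^3"
  have *: "transpose ?A *v x = x $ 1 *\<^sub>R a + x $ 2 *\<^sub>R b + x $ 3 *\<^sub>R c" for x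
    by (simp add: vec_eq_iff matrix_vector_mult_def transpose_def sum_3 mult.commute)
  have "det ?A \<noteq> 0 \<longleftrightarrow> surj ((*v) (transpose ?A))"
    by (metis det_transpose invertible_det_nz invertible_right_inverse matrix_right_invertible_surjective)
  also have "\<dots> \<longleftrightarrow> (\<forall>w. \<exists>r s t. w = r *\<^sub>R a + s *\<^sub>R b + t *\<^sub>R c)"
    unfolding surj_def *
    by (metis vector_3)
  finally show ?thesis .
qed

lemma det3_nonzero_iff_independent:
  "det3 a b c \<noteq> 0 \<longleftrightarrow>
    (\<forall>r s t. r *\<^sub>R a + s *\<^sub>R b + t *\<^sub>R c = 0 \<longrightarrow> r = 0 \<and> s = 0 \<and> t = 0)"
proof -
  let ?A = "vector [a, b, c] :: real^3^3"
  have *: "transpose ?A *v x = x $ 1 *\<^sub>R a + x $ 2 *\<^sub>R b + x $ 3 *\<^sub>R c" for x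
    by (simp add: vec_eq_iff matrix_vector_mult_def transpose_def sum_3 mult.commute)
  have "det ?A \<noteq> 0 \<longleftrightarrow> (\<forall>x. transpose ?A *v x = 0 \<longrightarrow> x = 0)"
    by (metis det_transpose invertible_det_nz invertible_left_inverse matrix_left_invertible_ker)
  also have "\<dots> \<longleftrightarrow> (\<forall>r s t. r *\<^sub>R a + s *\<^sub>R b + t *\<^sub>R c = 0 \<longrightarrow> r = 0 \<and> s = 0 \<and> t = 0)"
    unfolding * by (simp add: forall_vector_3 vec_eq_iff forall_3)
  finally show ?thesis .
qed

section \<open>Area densities and change of parameters\<close>

lemma smooth_on_imp_C1:
  assumes "smooth_on f S"
  shows "\<And>u. u \<in> S \<Longrightarrow> f differentiable (at u)"
    and "\<And>h. continuous_on S (\<lambda>u. frechet_derivative f (at u) h)"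
    and "continuous_on S f"
  using assms[unfolded smooth_on_def, rule_format, of 0] assms[unfolded smooth_on_def, rule_format, of 1]
  by auto

lemma smooth_on_subset:
  assumes "smooth_on f S" "T \<subseteq> S"
  shows "smooth_on f T"
proof -
  have "C_on k f S \<Longrightarrow> T \<subseteq> S \<Longrightarrow> C_on k f T" for k
    by (induction k f S rule: C_on.induct) (auto intro: continuous_on_subset)
  then show ?thesis
    using assms by (auto simp: smooth_on_def)
qed

lemma area_density_eq_det3:
  "area_density f \<eta> x u =
    det3 (frechet_derivative (f \<circ> x) (at u) (axis 1 1))
         (frechet_derivative (f \<circ> x) (at u) (axis 2 1)) (\<eta> (x u))"
  by (simp add: area_density_def)

lemma continuous_on_det3:
  assumes "continuous_on S a" "continuous_on S b" "continuous_on S c"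
  shows "continuous_on S (\<lambda>u. det3 (a u) (b u) (c u))"
  unfolding det_3 vector_3 by (intro continuous_intros assms)

lemma continuous_on_area_density:
  assumes "smooth_on (f \<circ> x) S" "continuous_on S (\<eta> \<circ> x)"
  shows "continuous_on S (area_density f \<eta> x)"
  unfolding area_density_eq_det3[abs_def]
  using assms by (intro continuous_on_det3 smooth_on_imp_C1(2)) (auto simp: o_def)

text \<open>The factorization is assumed only on an open set \<open>V\<close>, since transition maps
  are meaningful only on overlaps.\<close>

lemma frechet_derivative_reparam:
  assumes "open V" "u \<in> V" and eq: "\<And>v. v \<in> V \<Longrightarrow> g v = h (\<tau> v)"
    and h: "h differentiable (at (\<tau> u))" and t: "\<tau> differentiable (at u)"
  shows "g differentiable (at u)"
    and "frechet_derivative g (at u) =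
      frechet_derivative h (at (\<tau> u)) \<circ> frechet_derivative \<tau> (at u)"
proof -
  have "((h \<circ> \<tau>) has_derivative frechet_derivative h (at (\<tau> u)) \<circ> frechet_derivative \<tau> (at u)) (at u)"
    using diff_chain_at[OF t[unfolded frechet_derivative_works] h[unfolded frechet_derivative_works]] .
  then have "(g has_derivative frechet_derivative h (at (\<tau> u)) \<circ> frechet_derivative \<tau> (at u)) (at u)"
    by (rule has_derivative_transform_within_open[OF _ assms(1,2)]) (simp add: eq)
  then show "g differentiable (at u)" "frechet_derivative g (at u) =
      frechet_derivative h (at (\<tau> u)) \<circ> frechet_derivative \<tau> (at u)"
    by (blast intro: differentiableI frechet_derivative_at[symmetric])+
qed

lemma area_density_reparam:
  assumes "open V" "u \<in> V" and eq: "\<And>v. v \<in> V \<Longrightarrow> y v = x (\<tau> v)"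
    and "(f \<circ> x) differentiable (at (\<tau> u))" and "\<tau> differentiable (at u)"
  shows "area_density f \<eta> y u =
    det (matrix (frechet_derivative \<tau> (at u))) * area_density f \<eta> x (\<tau> u)"
proof -
  have "frechet_derivative (f \<circ> y) (at u) =
      frechet_derivative (f \<circ> x) (at (\<tau> u)) \<circ> frechet_derivative \<tau> (at u)"
    by (rule frechet_derivative_reparam(2)[OF assms(1,2) _ assms(4,5)]) (simp add: eq)
  then show ?thesis
    using det3_linear_comp[OF linear_frechet_derivative[OF assms(4)], of "frechet_derivative \<tau> (at u)"]
    by (simp add: area_density_eq_det3 eq[OF assms(2)])
qed

text \<open>The change of variables theorem is an equivalence: absolute integrability with a given
  integral on one side means the same on the other. For nonnegative measurable integrands, failing
  to be integrable means having infinite integral, so the equivalence becomes an equality in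
  \<open>ennreal\<close>.\<close>

lemma nn_integral_change_of_variables:
  fixes \<tau> :: "real^'m::{finite,wellorder} \<Rightarrow> real^'m::_" and g :: "real^'m::_ \<Rightarrow> real"
  assumes S: "S \<in> sets lebesgue"
    and der: "\<And>u. u \<in> S \<Longrightarrow> (\<tau> has_derivative \<tau>' u) (at u within S)"
    and inj: "inj_on \<tau> S"
    and nonneg: "\<And>u. 0 \<le> g u"
    and m1: "(\<lambda>u. indicator S u * (\<bar>det (matrix (\<tau>' u))\<bar> * g (\<tau> u))) \<in> borel_measurable lebesgue"
    and m2: "(\<lambda>v. indicator (\<tau> ` S) v * g v) \<in> borel_measurable lebesgue"
  shows "(\<integral>\<^sup>+u\<in>S. ennreal (\<bar>det (matrix (\<tau>' u))\<bar> * g (\<tau> u)) \<partial>lborel) =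
    (\<integral>\<^sup>+v\<in>\<tau> ` S. ennreal (g v) \<partial>lborel)"
proof -
  let ?d = "\<lambda>u. \<bar>det (matrix (\<tau>' u))\<bar> * g (\<tau> u)"
  have cv: "(?d absolutely_integrable_on S \<and> integral S ?d = b) \<longleftrightarrow>
     (g absolutely_integrable_on \<tau> ` S \<and> integral (\<tau> ` S) g = b)" for b
    using has_absolute_integral_change_of_variables[OF S der inj, of "\<lambda>v. vec (g v) :: real^1" "vec b"]
    by (simp add: absolutely_integrable_on_1_iff integral_on_1_eq vec_eq_iff)
  have *: "(\<integral>\<^sup>+u\<in>T. ennreal (h u) \<partial>lborel) =
      (if h absolutely_integrable_on T then ennreal (integral T h) else \<infinity>)"
    if "\<And>u. 0 \<le> h u" "(\<lambda>u. indicator T u * h u) \<in> borel_measurable lebesgue"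
    for h :: "real^'m::_ \<Rightarrow> real" and T
  proof -
    have e: "(\<integral>\<^sup>+u\<in>T. ennreal (h u) \<partial>lborel) = (\<integral>\<^sup>+u. ennreal (indicator T u * h u) \<partial>lebesgue)"
      unfolding nn_integral_completion
      by (intro nn_integral_cong) (auto split: split_indicator)
    show ?thesis
    proof (cases "h absolutely_integrable_on T")
      case True
      then have "integral T h = (\<integral>u. indicator T u * h u \<partial>lebesgue)"
        using set_lebesgue_integral_eq_integral(2)[OF True]
        by (simp add: set_lebesgue_integral_def)
      moreover have "integrable lebesgue (\<lambda>u. indicator T u * h u)"
        using True by (simp add: set_integrable_def)
      ultimately show ?thesis
        using True that(1) unfolding e by (simp add: nn_integral_eq_integral)
    next
      case False
      then have "\<not> integrable lebesgue (\<lambda>u. indicator T u * h u)"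
        by (simp add: set_integrable_def)
      then have "\<not> (\<integral>\<^sup>+u. ennreal (indicator T u * h u) \<partial>lebesgue) < \<infinity>"
        using integrableI_nonneg[OF that(2)] that(1) by auto
      then have "(\<integral>\<^sup>+u. ennreal (indicator T u * h u) \<partial>lebesgue) = \<infinity>"
        by (simp add: less_top[symmetric])
      then show ?thesis
        using False unfolding e by simp
    qed
  qed
  \<comment> \<open>The two instances of \<open>cv\<close> give the two directions: each starts from
    integrability on one side, with \<open>b\<close> chosen as the integral there.\<close>
  show ?thesis
    unfolding *[OF mult_nonneg_nonneg[OF abs_ge_zero nonneg] m1] *[OF nonneg m2]
    using cv[of "integral S ?d"] cv[of "integral (\<tau> ` S) g"] by auto
qed

section \<open>Curvature in a parametrization\<close>

text \<open>On the plane \<open>range F\<close> an alternating bilinear form is unique up to a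
  factor, and pulling \<open>det3 _ _ c\<close> back along \<open>L\<close> multiplies it by the
  determinant of \<open>L\<close>. Any \<open>c\<close> transverse to the plane yields the same
  quotient. As \<open>plane_det\<close> is a definite description over all bases, both uniqueness
  for an arbitrary basis and existence of one are needed.\<close>

lemma plane_det_eq_quotient:
  fixes F G :: "real^2 \<Rightarrow> real^3"
  assumes "linear F" "linear G" "inj F" "range G \<subseteq> range F"
    and L: "\<And>h. L (F h) = G h"
    and nz: "det3 (F (axis 1 1)) (F (axis 2 1)) c \<noteq> 0"
  shows "plane_det (range F) L =
    det3 (G (axis 1 1)) (G (axis 2 1)) c / det3 (F (axis 1 1)) (F (axis 2 1)) c"
    (is "_ = ?q")
proof -
  have combF: "det3 (F h) (F k) c = (h $ 1 * k $ 2 - k $ 1 * h $ 2) * det3 (F (axis 1 1)) (F (axis 2 1)) c" for h k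
    using linear_real2[OF assms(1), of h] linear_real2[OF assms(1), of k]
    by (simp add: det3_combination mult.commute)
  have combG: "det3 (G h) (G k) c = (h $ 1 * k $ 2 - k $ 1 * h $ 2) * det3 (G (axis 1 1)) (G (axis 2 1)) c" for h k
    using linear_real2[OF assms(2), of h] linear_real2[OF assms(2), of k]
    by (simp add: det3_combination mult.commute)
  have uniq: "det m = ?q"
    if b: "inj b" "independent (range b)" "span (range b) = range F"
      and m: "\<And>j. L (b j) = (\<Sum>i\<in>UNIV. m $ i $ j *\<^sub>R b i)" for b :: "2 \<Rightarrow> real^3" and m
  proof -
    have "b i \<in> range F" for i
      using b(3) span_superset[of "range b"] by auto
    from this[of 1] this[of 2] obtain h k where h: "b 1 = F h" and k: "b 2 = F k"
      by (elim rangeE)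
    have ind: "r = 0 \<and> s = 0" if "r *\<^sub>R b 1 + s *\<^sub>R b 2 = 0" for r s
    proof -
      have ne: "b 1 \<noteq> b 2"
        using b(1) by (simp add: inj_eq)
      let ?u = "\<lambda>v. if v = b 1 then r else s"
      have "(\<Sum>v\<in>{b 1, b 2}. ?u v *\<^sub>R v) = 0"
        using that ne by simp
      then have "?u (b 1) = 0 \<and> ?u (b 2) = 0"
        using independentD[OF b(2), of "{b 1, b 2}" ?u] by blast
      then show ?thesis
        using ne by auto
    qed
    \<comment> \<open>\<open>\<delta>\<close> is the determinant of the change of basis from the
      images of the axes to \<open>b\<close>. If it vanished, the two linear relations below would
      force \<open>h = 0\<close> by independence.\<close>
    define \<delta> where "\<delta> = h $ 1 * k $ 2 - k $ 1 * h $ 2"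
    have "\<delta> \<noteq> 0"
    proof
      assume "\<delta> = 0"
      then have "k $ 1 *\<^sub>R h + (- h $ 1) *\<^sub>R k = 0" "k $ 2 *\<^sub>R h + (- h $ 2) *\<^sub>R k = 0"
        by (simp_all add: \<delta>_def vec_eq_iff forall_2 mult.commute)
      then have "k $ 1 *\<^sub>R F h + (- h $ 1) *\<^sub>R F k = 0" "k $ 2 *\<^sub>R F h + (- h $ 2) *\<^sub>R F k = 0"
        by (simp_all flip: linear_scale[OF assms(1)] linear_add[OF assms(1)] add: linear_0[OF assms(1)])
      then have "h $ 1 = 0" "h $ 2 = 0"
        using ind[of "k $ 1" "- h $ 1"] ind[of "k $ 2" "- h $ 2"] by (simp_all add: h k)
      then have "h = 0"
        by (simp add: vec_eq_iff forall_2)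
      then show False
        using ind[of 1 0] h linear_0[OF assms(1)] by simp
    qed
    \<comment> \<open>The form at \<open>L (b 1)\<close>, \<open>L (b 2)\<close> is computed twice,
      from the coordinates \<open>h\<close>, \<open>k\<close> and from the matrix \<open>m\<close>;
      then \<open>\<delta>\<close> cancels.\<close>
    have "\<delta> * det3 (G (axis 1 1)) (G (axis 2 1)) c = det3 (L (b 1)) (L (b 2)) c"
      unfolding h k L combG[of h k] \<delta>_def ..
    also have "\<dots> = det m * det3 (F h) (F k) c"
      using m[of 1] m[of 2] by (simp add: sum_2 det3_combination det_2 mult.commute flip: h k)
    also have "\<dots> = \<delta> * (det m * det3 (F (axis 1 1)) (F (axis 2 1)) c)"
      unfolding combF[of h k] \<delta>_def by simp
    finally show ?thesis
      using \<open>\<delta> \<noteq> 0\<close> nz by (simp add: field_simps)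
  qed
  define b where "b = (\<lambda>i::2. F (axis i 1))"
  have rb: "range b = F ` Basis"
    by (auto simp: b_def Basis_vec_def)
  \<comment> \<open>The inclusion of ranges supplies the columns of \<open>m\<close>: the
    coordinates, with respect to \<open>F\<close>, of the images of the axes under
    \<open>G\<close>.\<close>
  have "\<exists>h. F h = G (axis j 1)" for j
    using assms(4) by (metis rangeE rangeI subsetD)
  then obtain H where H: "\<And>j. F (H j) = G (axis j 1)"
    by metis
  define m where "m = (\<chi> i j. H j $ i)"
  have bm: "inj b" "independent (range b)" "span (range b) = range F"
    "\<And>j. L (b j) = (\<Sum>i\<in>UNIV. m $ i $ j *\<^sub>R b i)"
  proof -
    show "inj b"
      by (auto intro!: injI simp: b_def axis_eq_axis dest!: injD[OF assms(3)])
    show "independent (range b)"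
      unfolding rb using linear_independent_injective_image[OF assms(1) independent_Basis]
      using assms(3) by (simp add: inj_on_subset)
    show "span (range b) = range F"
      unfolding rb by (simp add: linear_span_image[OF assms(1)])
    show "L (b j) = (\<Sum>i\<in>UNIV. m $ i $ j *\<^sub>R b i)" for j
      using H[of j] linear_real2[OF assms(1), of "H j"]
      by (simp add: b_def m_def L sum_2)
  qed
  show ?thesis
    unfolding plane_det_def
  proof (rule the_equality)
    show "\<exists>(b :: 2 \<Rightarrow> real^3) (m :: real^2^2). inj b \<and> independent (range b) \<and> span (range b) = range F \<and>
        (\<forall>j. L (b j) = (\<Sum>i\<in>UNIV. m $ i $ j *\<^sub>R b i)) \<and> ?q = det m"
      by (intro exI[of _ b] exI[of _ m] conjI allI bm uniq[OF bm, symmetric])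
  qed (use uniq in blast)
qed

lemma smooth_surface_param:
  assumes "smooth_surface X A" "(\<Omega>, x) \<in> A"
  shows "open \<Omega>" "inj_on x \<Omega>" "continuous_map (top_of_set \<Omega>) X x"
    "embedding_map (top_of_set \<Omega>) X x" "openin X (x ` \<Omega>)" "x ` \<Omega> \<subseteq> topspace X"
proof -
  show *: "open \<Omega>" "embedding_map (top_of_set \<Omega>) X x" "openin X (x ` \<Omega>)"
    using assms by (auto simp: smooth_surface_def)
  show "inj_on x \<Omega>" "continuous_map (top_of_set \<Omega>) X x"
    using *(2) homeomorphic_imp_continuous_map[of "top_of_set \<Omega>" "subtopology X (x ` \<Omega>)" x]
    by (auto simp: embedding_map_def homeomorphic_map_def continuous_map_in_subtopology)
  show "x ` \<Omega> \<subseteq> topspace X"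
    using *(3) by (rule openin_subset)
qed

lemma open_vimage_param:
  assumes "open \<Omega>" "continuous_map (top_of_set \<Omega>) X x" "openin X V"
  shows "open {u \<in> \<Omega>. x u \<in> V}"
  using openin_continuous_map_preimage[OF assms(2,3)] assms(1)
  by (simp add: openin_open_eq)

lemma transition_right:
  assumes "u \<in> overlap (\<Omega>', y) (\<Omega>, x)"
  shows "transition (\<Omega>', y) (\<Omega>, x) u \<in> \<Omega>" "x (transition (\<Omega>', y) (\<Omega>, x) u) = y u"
  using assms by (auto simp: overlap_def transition_def inv_into_into f_inv_into_f)

lemma smooth_surface_overlap:
  assumes "smooth_surface X A" "(\<Omega>, x) \<in> A" "(\<Omega>', y) \<in> A"
  shows "open (overlap (\<Omega>', y) (\<Omega>, x))"
    and "u \<in> overlap (\<Omega>', y) (\<Omega>, x) \<Longrightarrow> transition (\<Omega>', y) (\<Omega>, x) differentiable (at u)"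
proof -
  show "open (overlap (\<Omega>', y) (\<Omega>, x))"
    using open_vimage_param[OF smooth_surface_param(1,3)[OF assms(1,3)] smooth_surface_param(5)[OF assms(1,2)]]
    by (simp add: overlap_def)
  show "transition (\<Omega>', y) (\<Omega>, x) differentiable (at u)" if "u \<in> overlap (\<Omega>', y) (\<Omega>, x)"
    using assms that by (intro smooth_on_imp_C1(1)[OF _ that]) (auto simp: smooth_surface_def)
qed

lemma smooth_map_param:
  "smooth_map A g \<Longrightarrow> (\<Omega>, x) \<in> A \<Longrightarrow> smooth_on (g \<circ> x) \<Omega>"
  by (auto simp: smooth_map_def)

text \<open>\<open>T\<close> is the derivative of the transition map at \<open>u'\<close>. What
  matters is that one \<open>T\<close> serves all maps \<open>g\<close> at once: comparing
  \<open>f\<close> with a second map then shows that the differential between them does not depend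
  on the parametrization.\<close>

lemma frechet_derivative_change_param:
  assumes "smooth_surface X A" "(\<Omega>, x) \<in> A" "(\<Omega>', y) \<in> A" "u \<in> \<Omega>" "u' \<in> \<Omega>'" "y u' = x u"
  obtains T where "\<And>g. smooth_map A g \<Longrightarrow>
    frechet_derivative (g \<circ> y) (at u') = frechet_derivative (g \<circ> x) (at u) \<circ> T"
proof -
  let ?\<tau> = "transition (\<Omega>', y) (\<Omega>, x)"
  have ov: "u' \<in> overlap (\<Omega>', y) (\<Omega>, x)"
    using assms by (auto simp: overlap_def)
  then have "?\<tau> u' = u"
    using transition_right[OF ov] smooth_surface_param(2)[OF assms(1,2)] assms(4,6)
    by (auto dest: inj_onD)
  have "frechet_derivative (g \<circ> y) (at u') =
      frechet_derivative (g \<circ> x) (at u) \<circ> frechet_derivative ?\<tau> (at u')" if "smooth_map A g" for g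
  proof -
    have "frechet_derivative (g \<circ> y) (at u') =
      frechet_derivative (g \<circ> x) (at (?\<tau> u')) \<circ> frechet_derivative ?\<tau> (at u')"
    proof (rule frechet_derivative_reparam(2)[OF smooth_surface_overlap(1)[OF assms(1-3)] ov])
      show "(g \<circ> y) v = (g \<circ> x) (?\<tau> v)" if "v \<in> overlap (\<Omega>', y) (\<Omega>, x)" for v
        using transition_right(2)[OF that] by simp
      show "g \<circ> x differentiable at (?\<tau> u')"
        unfolding \<open>?\<tau> u' = u\<close> using smooth_on_imp_C1(1)[OF smooth_map_param[OF \<open>smooth_map A g\<close> assms(2)] assms(4)] .
    qed (rule smooth_surface_overlap(2)[OF assms(1-3) ov])
    then show ?thesis
      by (simp add: \<open>?\<tau> u' = u\<close>)
  qed
  then show ?thesis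
    using that by blast
qed

lemma tangent_plane_param:
  assumes "smooth_surface X A" "smooth_map A f" "(\<Omega>, x) \<in> A" "u \<in> \<Omega>"
  shows "tangent_plane A f (x u) = range (frechet_derivative (f \<circ> x) (at u))"
proof
  show "range (frechet_derivative (f \<circ> x) (at u)) \<subseteq> tangent_plane A f (x u)"
    using assms(3,4) by (force simp: tangent_plane_def)
  have "frechet_derivative (f \<circ> y) (at v) h \<in> range (frechet_derivative (f \<circ> x) (at u))"
    if "(\<Omega>', y) \<in> A" "v \<in> \<Omega>'" "y v = x u" for \<Omega>' y v h
    using frechet_derivative_change_param[OF assms(1,3) that(1) assms(4) that(2,3)] assms(2)
    by (metis comp_apply rangeI)
  then show "tangent_plane A f (x u) \<subseteq> range (frechet_derivative (f \<circ> x) (at u))"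
    by (auto simp: tangent_plane_def)
qed

text \<open>The definite description has only one candidate: two parametrizations are related by the
  same \<open>T\<close> for \<open>f\<close> and for \<open>g\<close>, and injectivity of the
  derivative of \<open>f\<close> forces \<open>h = T k\<close>.\<close>

lemma surface_differential_param:
  assumes "smooth_surface X A" "immersion A f" "smooth_map A g" "(\<Omega>, x) \<in> A" "u \<in> \<Omega>"
  shows "surface_differential A f g (x u) (frechet_derivative (f \<circ> x) (at u) h) =
    frechet_derivative (g \<circ> x) (at u) h"
  unfolding surface_differential_def
proof (rule the_equality)
  show "\<exists>(\<Omega>', y)\<in>A. \<exists>v\<in>\<Omega>'. \<exists>k. y v = x u \<and>
      frechet_derivative (f \<circ> x) (at u) h = frechet_derivative (f \<circ> y) (at v) k \<and>
      frechet_derivative (g \<circ> x) (at u) h = frechet_derivative (g \<circ> y) (at v) k"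
    using assms(4,5) by blast
next
  fix z
  assume "\<exists>(\<Omega>', y)\<in>A. \<exists>v\<in>\<Omega>'. \<exists>k. y v = x u \<and>
      frechet_derivative (f \<circ> x) (at u) h = frechet_derivative (f \<circ> y) (at v) k \<and>
      z = frechet_derivative (g \<circ> y) (at v) k"
  then obtain \<Omega>' y v k where y: "(\<Omega>', y) \<in> A" "v \<in> \<Omega>'" "y v = x u"
    and eq: "frechet_derivative (f \<circ> x) (at u) h = frechet_derivative (f \<circ> y) (at v) k"
    and z: "z = frechet_derivative (g \<circ> y) (at v) k"
    by blast
  obtain T where T: "\<And>g. smooth_map A g \<Longrightarrow>
      frechet_derivative (g \<circ> y) (at v) = frechet_derivative (g \<circ> x) (at u) \<circ> T"
    using frechet_derivative_change_param[OF assms(1,4) y(1) assms(5) y(2,3)] by metis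
  have "inj (frechet_derivative (f \<circ> x) (at u))" "smooth_map A f"
    using assms(2,4,5) by (auto simp: immersion_def)
  then have "h = T k"
    using eq T[of f] by (simp add: inj_eq)
  then show "z = frechet_derivative (g \<circ> x) (at u) h"
    using z T[OF assms(3)] by simp
qed

text \<open>The determinant formula is applied with \<open>c = \<nu> (x u)\<close>, so both
  determinants become area densities with the common normal \<nu>. In the numerator \<nu> is at once
  the map and its normal, which is the situation on the unit sphere.\<close>

lemma normal_map_curvature_param:
  assumes "smooth_surface X A" "immersion A f" "smooth_map A \<nu>" "(\<Omega>, x) \<in> A" "u \<in> \<Omega>"
    and "range (frechet_derivative (\<nu> \<circ> x) (at u)) \<subseteq> range (frechet_derivative (f \<circ> x) (at u))"
    and "area_density f \<nu> x u \<noteq> 0"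
  shows "normal_map_curvature A f \<nu> (x u) = area_density \<nu> \<nu> x u / area_density f \<nu> x u"
proof -
  have f: "smooth_map A f" "inj (frechet_derivative (f \<circ> x) (at u))"
    using assms(2,4,5) by (auto simp: immersion_def)
  have lin: "linear (frechet_derivative (g \<circ> x) (at u))" if "smooth_map A g" for g
    using smooth_on_imp_C1(1)[OF smooth_map_param[OF that assms(4)] assms(5)]
    by (rule linear_frechet_derivative)
  show ?thesis
    unfolding normal_map_curvature_def tangent_plane_param[OF assms(1) f(1) assms(4,5)] area_density_eq_det3
    using assms(7)[unfolded area_density_eq_det3]
    by (intro plane_det_eq_quotient lin f assms(3,6) surface_differential_param[OF assms(1-5)])
qed

section \<open>Area in a parametrization\<close>

text \<open>This makes the area a well-defined number: an arbitrary decomposition is pulled into the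
  single parametrization \<open>x\<close>, where its pieces partition \<open>E\<close>. Only
  transition maps into \<open>x\<close> are constrained, so that the lemma covers both the atlas of
  the surface and the regular parametrizations of the sphere.\<close>

lemma has_area_param_iff:
  assumes A: "\<And>\<Omega>' y. (\<Omega>', y) \<in> A \<Longrightarrow> continuous_on \<Omega>' (area_density f \<eta> y) \<and> inj_on y \<Omega>'"
    and tr: "\<And>\<Omega>' y u. (\<Omega>', y) \<in> A \<Longrightarrow> u \<in> overlap (\<Omega>', y) (\<Omega>, x) \<Longrightarrow>
      transition (\<Omega>', y) (\<Omega>, x) differentiable (at u) \<and>
      area_density f \<eta> y u =
        det (matrix (frechet_derivative (transition (\<Omega>', y) (\<Omega>, x)) (at u))) *
        area_density f \<eta> x (transition (\<Omega>', y) (\<Omega>, x) u)"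
    and x: "(\<Omega>, x) \<in> A" "open \<Omega>" and E: "E \<subseteq> \<Omega>" "E \<in> sets borel"
  shows "has_area A f \<eta> (x ` E) a \<longleftrightarrow>
    a = (\<integral>\<^sup>+u\<in>E. ennreal \<bar>area_density f \<eta> x u\<bar> \<partial>lborel)" (is "_ \<longleftrightarrow> a = ?I")
proof
  assume "a = ?I"
  \<comment> \<open>One piece is padded with empty ones, since decompositions are indexed by all
    natural numbers.\<close>
  define C where "C = (\<lambda>i::nat. if i = 0 then E else {})"
  have "?I = (\<Sum>i. \<integral>\<^sup>+u\<in>C i. ennreal \<bar>area_density f \<eta> x u\<bar> \<partial>lborel)"
    by (subst suminf_finite[of "{0}"]) (auto simp: C_def)
  moreover have "disjoint_family (\<lambda>i. x ` C i)" "(\<Union>i. x ` C i) = x ` E"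
    by (auto simp: C_def disjoint_family_on_def split: if_splits)
  moreover have "C i \<in> sets borel \<and> C i \<subseteq> \<Omega>" for i
    using E by (simp add: C_def)
  ultimately show "has_area A f \<eta> (x ` E) a"
    unfolding has_area_def \<open>a = ?I\<close> using x(1)
    by (intro exI[of _ "\<lambda>_. \<Omega>"] exI[of _ "\<lambda>_. x"] exI[of _ C]) auto
next
  assume "has_area A f \<eta> (x ` E) a"
  then obtain \<Omega>' y C where all: "\<forall>i::nat. (\<Omega>' i, y i) \<in> A \<and> C i \<in> sets borel \<and> C i \<subseteq> \<Omega>' i"
    and disj: "disjoint_family (\<lambda>i. y i ` C i)" and un: "(\<Union>i. y i ` C i) = x ` E"
    and a: "a = (\<Sum>i. \<integral>\<^sup>+u\<in>C i. ennreal \<bar>area_density f \<eta> (y i) u\<bar> \<partial>lborel)"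
    unfolding has_area_def by (elim exE conjE)
  have y: "\<And>i. (\<Omega>' i, y i) \<in> A" and C: "\<And>i. C i \<in> sets borel" "\<And>i. C i \<subseteq> \<Omega>' i"
    using all by auto
  define \<tau> where "\<tau> = (\<lambda>i. transition (\<Omega>' i, y i) (\<Omega>, x))"
  have ov: "u \<in> overlap (\<Omega>' i, y i) (\<Omega>, x)" if "u \<in> C i" for i u
  proof -
    have "y i u \<in> x ` E"
      using that un by blast
    then show ?thesis
      using that C(2)[of i] E(1) by (auto simp: overlap_def)
  qed
  have tau: "\<tau> i u \<in> \<Omega>" "x (\<tau> i u) = y i u" if "u \<in> C i" for i u
    using transition_right[OF ov[OF that]] by (auto simp: \<tau>_def)
  have im: "x ` \<tau> i ` C i = y i ` C i" for i
    by (simp add: image_image tau(2) cong: image_cong)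
  have leb: "C i \<in> sets lebesgue" for i
    using C(1)[of i] by simp
  \<comment> \<open>The images of the Borel pieces are only obtained as Lebesgue sets, which is why
    the final summation takes place over \<open>lebesgue\<close>.\<close>
  have leb\<tau>: "\<tau> i ` C i \<in> sets lebesgue" for i
  proof (rule differentiable_image_in_sets_lebesgue[OF leb])
    show "\<tau> i differentiable_on C i"
      using tr[OF y ov] unfolding \<tau>_def
      by (auto simp: differentiable_on_def intro: differentiable_at_withinI)
  qed simp
  have un\<tau>: "(\<Union>i. \<tau> i ` C i) = E"
  proof (rule inj_on_image_eq_iff[THEN iffD1])
    show "inj_on x \<Omega>"
      using A[OF x(1)] by blast
    show "x ` (\<Union>i. \<tau> i ` C i) = x ` E"
      using im un by (simp add: image_UN)
    show "(\<Union>i. \<tau> i ` C i) \<subseteq> \<Omega>" "E \<subseteq> \<Omega>"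
      using tau(1) E(1) by auto
  qed
  have disj\<tau>: "disjoint_family (\<lambda>i. \<tau> i ` C i)"
    unfolding disjoint_family_on_def
  proof (intro ballI impI)
    fix i j :: nat assume "i \<noteq> j"
    then have "x ` \<tau> i ` C i \<inter> x ` \<tau> j ` C j = {}"
      using disj unfolding im disjoint_family_on_def by blast
    then show "\<tau> i ` C i \<inter> \<tau> j ` C j = {}"
      by blast
  qed
  \<comment> \<open>Cutting off outside \<Omega> gives a function measurable on the whole plane; the
    density is controlled only on \<Omega>.\<close>
  let ?g = "\<lambda>v. indicator \<Omega> v *\<^sub>R \<bar>area_density f \<eta> x v\<bar>"
  have meas_g: "?g \<in> borel_measurable borel"
    using A[OF x(1)] x(2) by (intro borel_measurable_continuous_on_indicator continuous_intros) auto
  have piece: "(\<integral>\<^sup>+u\<in>C i. ennreal \<bar>area_density f \<eta> (y i) u\<bar> \<partial>lborel) =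
      (\<integral>\<^sup>+v\<in>\<tau> i ` C i. ennreal (?g v) \<partial>lborel)" for i
  proof -
    let ?D = "\<lambda>u. frechet_derivative (\<tau> i) (at u)"
    have dens: "\<bar>det (matrix (?D u))\<bar> * ?g (\<tau> i u) = \<bar>area_density f \<eta> (y i) u\<bar>" if "u \<in> C i" for u
      using tr[OF y ov[OF that]] tau(1)[OF that] by (simp add: \<tau>_def abs_mult)
    have "(\<integral>\<^sup>+u\<in>C i. ennreal \<bar>area_density f \<eta> (y i) u\<bar> \<partial>lborel) =
      (\<integral>\<^sup>+u\<in>C i. ennreal (\<bar>det (matrix (?D u))\<bar> * ?g (\<tau> i u)) \<partial>lborel)"
      using dens by (intro nn_integral_cong) (auto split: split_indicator)
    also have "\<dots> = (\<integral>\<^sup>+v\<in>\<tau> i ` C i. ennreal (?g v) \<partial>lborel)"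
    proof (rule nn_integral_change_of_variables[OF leb])
      show "(\<tau> i has_derivative ?D u) (at u within C i)" if "u \<in> C i" for u
        using tr[OF y ov[OF that]] unfolding \<tau>_def frechet_derivative_works
        by (blast intro: has_derivative_at_withinI)
      show "inj_on (\<tau> i) (C i)"
        using A[OF y[of i]] tau(2) C(2)[of i] by (metis inj_on_def subsetD)
      \<comment> \<open>By \<open>dens\<close> the transformed integrand is the density of
        \<open>y i\<close>, continuous on its parameter domain. Its measurability thus needs no
        study of the derivative of \<open>\<tau> i\<close>.\<close>
      have "(\<lambda>u. indicator (C i) u *\<^sub>R \<bar>area_density f \<eta> (y i) u\<bar>) \<in> borel_measurable borel"
        using A[OF y[of i]] C[of i]
        by (intro borel_measurable_continuous_on_indicator continuous_intros) (auto intro: continuous_on_subset)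
      also have "(\<lambda>u. indicator (C i) u *\<^sub>R \<bar>area_density f \<eta> (y i) u\<bar>) =
          (\<lambda>u. indicator (C i) u * (\<bar>det (matrix (?D u))\<bar> * ?g (\<tau> i u)))"
        using dens by (auto split: split_indicator)
      finally show "\<dots> \<in> borel_measurable lebesgue"
        by (simp add: measurable_completion)
      show "(\<lambda>v. indicator (\<tau> i ` C i) v * ?g v) \<in> borel_measurable lebesgue"
        using leb\<tau>[of i] meas_g
        by (intro borel_measurable_times borel_measurable_indicator) (auto intro: measurable_completion)
    qed auto
    finally show ?thesis .
  qed
  have "a = (\<Sum>i. \<integral>\<^sup>+v\<in>\<tau> i ` C i. ennreal (?g v) \<partial>lebesgue)"
    unfolding a piece nn_integral_completion ..
  also have "\<dots> = (\<integral>\<^sup>+v\<in>(\<Union>i. \<tau> i ` C i). ennreal (?g v) \<partial>lebesgue)"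
    using meas_g by (intro nn_integral_disjoint_family[symmetric] leb\<tau> disj\<tau>) (auto intro: measurable_completion)
  also have "\<dots> = ?I"
    unfolding un\<tau> nn_integral_completion using E(1)
    by (intro nn_integral_cong) (auto split: split_indicator)
  finally show "a = ?I" .
qed

lemma surface_area_param:
  assumes "\<And>\<Omega>' y. (\<Omega>', y) \<in> A \<Longrightarrow> continuous_on \<Omega>' (area_density f \<eta> y) \<and> inj_on y \<Omega>'"
    and "\<And>\<Omega>' y u. (\<Omega>', y) \<in> A \<Longrightarrow> u \<in> overlap (\<Omega>', y) (\<Omega>, x) \<Longrightarrow>
      transition (\<Omega>', y) (\<Omega>, x) differentiable (at u) \<and>
      area_density f \<eta> y u =
        det (matrix (frechet_derivative (transition (\<Omega>', y) (\<Omega>, x)) (at u))) *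
        area_density f \<eta> x (transition (\<Omega>', y) (\<Omega>, x) u)"
    and "(\<Omega>, x) \<in> A" "open \<Omega>" "E \<subseteq> \<Omega>" "E \<in> sets borel"
  shows "surface_area A f \<eta> (x ` E) =
    enn2real (\<integral>\<^sup>+u\<in>E. ennreal \<bar>area_density f \<eta> x u\<bar> \<partial>lborel)"
proof -
  have "has_area A f \<eta> (x ` E) = (\<lambda>a. a = (\<integral>\<^sup>+u\<in>E. ennreal \<bar>area_density f \<eta> x u\<bar> \<partial>lborel))"
    by (rule ext) (rule has_area_param_iff[OF assms])
  then show ?thesis
    by (simp add: surface_area_def)
qed

section \<open>Birkhoff-Gauss maps\<close>

lemma smooth_norm_directional_derivative:
  assumes "smooth_norm N" "v \<noteq> 0"
  shows "((\<lambda>t. N (v + t *\<^sub>R w)) has_real_derivative frechet_derivative N (at v) w) (at 0)"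
proof -
  have N: "(N has_derivative frechet_derivative N (at v)) (at v)"
    using assms smooth_on_imp_C1(1)[of N "- {0}" v]
    by (simp add: smooth_norm_def frechet_derivative_works[symmetric])
  have "((\<lambda>t. v + t *\<^sub>R w) has_derivative (\<lambda>t. t *\<^sub>R w)) (at (0::real))"
    by (auto intro!: derivative_eq_intros)
  from has_derivative_compose[OF this, of N "frechet_derivative N (at v)"] N
  have "((\<lambda>t. N (v + t *\<^sub>R w)) has_derivative (\<lambda>t. frechet_derivative N (at v) (t *\<^sub>R w))) (at 0)"
    by simp
  then show ?thesis
    using linear_scale[OF has_derivative_linear[OF N]]
    by (simp add: has_field_derivative_def mult_commute_abs)
qed

text \<open>Euler's relation for a function homogeneous of degree one. Restricting to
  \<open>\<bar>t\<bar> < 1\<close> keeps \<open>1 + t\<close> positive, so no absolute value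
  remains.\<close>

lemma norm_derivative_radial:
  assumes "is_norm N" "smooth_norm N" "v \<noteq> 0"
  shows "frechet_derivative N (at v) v = N v"
proof -
  have eq: "N (v + t *\<^sub>R v) = (1 + t) * N v" if "\<bar>t\<bar> < 1" for t
  proof -
    have "v + t *\<^sub>R v = (1 + t) *\<^sub>R v"
      by (simp add: algebra_simps)
    then show ?thesis
      using assms(1) that by (simp add: is_norm_def)
  qed
  have "((\<lambda>t. (1 + t) * N v) has_real_derivative N v) (at 0)"
    by (auto intro!: derivative_eq_intros)
  then have "((\<lambda>t. N (v + t *\<^sub>R v)) has_real_derivative N v) (at 0)"
    by (rule has_field_derivative_transform_within[where d = 1]) (simp_all add: eq dist_real_def)
  then show ?thesis
    using DERIV_unique smooth_norm_directional_derivative[OF assms(2,3)] by blast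
qed

text \<open>Birkhoff orthogonality makes \<open>t = 0\<close> a minimum of the norm along the line
  through \<open>v\<close> in direction \<open>w\<close>, and the derivative vanishes there.\<close>

lemma birkhoff_orthogonal_norm_derivative:
  assumes "smooth_norm N" "v \<noteq> 0" "birkhoff_orthogonal N v P" "w \<in> P"
  shows "frechet_derivative N (at v) w = 0"
  using smooth_norm_directional_derivative[OF assms(1,2)]
proof (rule DERIV_local_min[where d = 1])
  show "\<forall>t. \<bar>0 - t\<bar> < 1 \<longrightarrow> N (v + 0 *\<^sub>R w) \<le> N (v + t *\<^sub>R w)"
    using assms(3,4) by (auto simp: birkhoff_orthogonal_def)
qed simp

text \<open>The derivative of \<open>N\<close> at \<open>\<eta>\<close> is \<open>1\<close> on \<open>\<eta>\<close> and \<open>0\<close> both on the tangent plane, by Birkhoff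
  orthogonality, and on the range of \<open>d\<eta>\<close>, since \<open>N \<circ> \<eta>\<close> is constant.\<close>

lemma birkhoff_gauss_map_param:
  assumes N: "is_norm N" "smooth_norm N" and X: "smooth_surface X A" and f: "immersion A f"
    and \<eta>: "birkhoff_gauss_map N X A f \<eta>" and x: "(\<Omega>, x) \<in> A" "u \<in> \<Omega>"
  shows "range (frechet_derivative (\<eta> \<circ> x) (at u)) \<subseteq> range (frechet_derivative (f \<circ> x) (at u))"
    and "area_density f \<eta> x u \<noteq> 0"
proof -
  let ?F = "frechet_derivative (f \<circ> x) (at u)" and ?G = "frechet_derivative (\<eta> \<circ> x) (at u)"
  let ?D = "frechet_derivative N (at (\<eta> (x u)))"
  have sm: "smooth_map A f" "smooth_map A \<eta>" and inj: "inj ?F"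
    using f \<eta> x by (auto simp: immersion_def birkhoff_gauss_map_def)
  have top: "x v \<in> topspace X" if "v \<in> \<Omega>" for v
    using smooth_surface_param(6)[OF X x(1)] that by blast
  have unit: "N (\<eta> (x v)) = 1" if "v \<in> \<Omega>" for v
    using \<eta> top[OF that] by (auto simp: birkhoff_gauss_map_def unit_sphere_def)
  have nz: "\<eta> (x u) \<noteq> 0"
    using unit[OF x(2)] N(1) unfolding is_norm_def by (metis zero_neq_one)
  have diff: "(f \<circ> x) differentiable (at u)" "(\<eta> \<circ> x) differentiable (at u)"
    using smooth_on_imp_C1(1)[OF smooth_map_param[OF _ x(1)] x(2)] sm by auto
  note linF = linear_frechet_derivative[OF diff(1)]
  have N': "(N has_derivative ?D) (at (\<eta> (x u)))"
    using N(2) nz smooth_on_imp_C1(1)[of N "- {0}" "\<eta> (x u)"]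
    by (simp add: smooth_norm_def frechet_derivative_works[symmetric])
  note linD = has_derivative_linear[OF N']
  have DF: "?D (?F h) = 0" for h
  proof (rule birkhoff_orthogonal_norm_derivative[OF N(2) nz])
    show "birkhoff_orthogonal N (\<eta> (x u)) (range ?F)"
      using \<eta> top[OF x(2)] tangent_plane_param[OF X sm(1) x] by (auto simp: birkhoff_gauss_map_def)
  qed simp
  have D\<eta>: "?D (\<eta> (x u)) = 1"
    using norm_derivative_radial[OF N nz] unit[OF x(2)] by simp
  have DG: "?D (?G h) = 0" for h
  proof -
    have "((\<lambda>v. N ((\<eta> \<circ> x) v)) has_derivative (\<lambda>h. ?D (?G h))) (at u)"
      using has_derivative_compose[OF diff(2)[unfolded frechet_derivative_works], of N ?D] N' by simp
    moreover have "((\<lambda>v. N ((\<eta> \<circ> x) v)) has_derivative (\<lambda>h. 0)) (at u)"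
      using smooth_surface_param(1)[OF X x(1)] x(2)
      by (rule has_derivative_transform_within_open[OF has_derivative_const[of 1]]) (simp add: unit)
    ultimately show ?thesis
      using has_derivative_unique by metis
  qed
  show nonzero: "area_density f \<eta> x u \<noteq> 0"
    unfolding area_density_eq_det3 det3_nonzero_iff_independent
  proof (intro allI impI)
    fix r s t
    assume eq: "r *\<^sub>R ?F (axis 1 1) + s *\<^sub>R ?F (axis 2 1) + t *\<^sub>R \<eta> (x u) = 0"
    then have "?D (r *\<^sub>R ?F (axis 1 1) + s *\<^sub>R ?F (axis 2 1) + t *\<^sub>R \<eta> (x u)) = 0"
      by (simp add: linear_0[OF linD])
    then have t: "t = 0"
      by (simp add: linear_add[OF linD] linear_scale[OF linD] DF D\<eta>)
    have "?F (vector [r, s]) = 0"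
      using eq t linear_real2[OF linF, of "vector [r, s]"] by simp
    then have "vector [r, s] = (0 :: real^2)"
      using inj linear_0[OF linF] by (metis injD)
    then show "r = 0 \<and> s = 0 \<and> t = 0"
      using t by (metis vector_2 zero_index)
  qed
  show "range ?G \<subseteq> range ?F"
  proof (intro image_subsetI)
    fix h
    \<comment> \<open>The tangent frame and \<eta> form a basis of three-space, and
      \<open>?D\<close> reads off the coefficient of \<eta>.\<close>
    obtain r s t where eq: "?G h = r *\<^sub>R ?F (axis 1 1) + s *\<^sub>R ?F (axis 2 1) + t *\<^sub>R \<eta> (x u)"
      using nonzero unfolding area_density_eq_det3 det3_nonzero_iff_surj by metis
    have "t = 0"
      using DG[of h] unfolding eq by (simp add: linear_add[OF linD] linear_scale[OF linD] DF D\<eta>)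
    then have "?G h = ?F (vector [r, s])"
      using eq linear_real2[OF linF, of "vector [r, s]"] by simp
    then show "?G h \<in> range ?F"
      by simp
  qed
qed

lemma regular_param:
  assumes "(\<Omega>, x) \<in> regular_params S"
  shows "open \<Omega>" "smooth_on x \<Omega>" "continuous_map (top_of_set \<Omega>) (top_of_set S) x" "inj_on x \<Omega>"
    "openin (top_of_set S) (x ` \<Omega>)"
proof -
  show *: "open \<Omega>" "smooth_on x \<Omega>" "openin (top_of_set S) (x ` \<Omega>)"
    using assms by (auto simp: regular_params_def)
  have "embedding_map (top_of_set \<Omega>) (top_of_set S) x"
    using assms by (auto simp: regular_params_def)
  then show "inj_on x \<Omega>" "continuous_map (top_of_set \<Omega>) (top_of_set S) x"
    using homeomorphic_imp_continuous_map[of "top_of_set \<Omega>" "subtopology (top_of_set S) (x ` \<Omega>)" x]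
    by (auto simp: embedding_map_def homeomorphic_map_def continuous_map_in_subtopology)
qed

text \<open>The inverse function theorem is applied to the cone \<open>(u, t) \<mapsto> t g(u)\<close>, a map of three-space:
  its derivative is invertible where the area density of \<open>g\<close> does not vanish. The local inverse
  then gives both the openness of the image of \<open>g\<close> in the sphere and the differentiability of
  the transition maps.\<close>

lemma unit_sphere_param:
  fixes g :: "real^2 \<Rightarrow> real^3"
  assumes N: "is_norm N" and g: "smooth_on g \<Omega>" and "open \<Omega>" "u0 \<in> \<Omega>"
    and sphere: "\<And>u. u \<in> \<Omega> \<Longrightarrow> N (g u) = 1"
    and nz: "\<And>u. u \<in> \<Omega> \<Longrightarrow> area_density id id g u \<noteq> 0"
  obtains \<Omega>' where "u0 \<in> \<Omega>'" "\<Omega>' \<subseteq> \<Omega>" "(\<Omega>', g) \<in> regular_params (unit_sphere N)"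
    "\<And>\<Omega>\<^sub>1 y u. (\<Omega>\<^sub>1, y) \<in> regular_params (unit_sphere N) \<Longrightarrow> u \<in> overlap (\<Omega>\<^sub>1, y) (\<Omega>', g) \<Longrightarrow>
      transition (\<Omega>\<^sub>1, y) (\<Omega>', g) differentiable (at u)"
proof -
  \<comment> \<open>Three-space is read as parameter plane times scale: \<open>q\<close> forgets the
    scale, and \<open>j\<close> puts the plane at height 1, where the cone map \<open>H\<close>
    restricts to \<open>g\<close>.\<close>
  define q where "q = (\<lambda>w::real^3. vector [w $ 1, w $ 2] :: real^2)"
  define j where "j = (\<lambda>u::real^2. vector [u $ 1, u $ 2, 1] :: real^3)"
  have qj [simp]: "q (j u) = u" "j u $ 3 = 1" for u
    by (simp_all add: q_def j_def vec_eq_iff forall_2)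
  have q_nth [simp]: "q w $ 1 = w $ 1" "q w $ 2 = w $ 2" for w
    by (simp_all add: q_def)
  have "linear q"
    by (rule linearI) (simp_all add: q_def vec_eq_iff forall_2)
  then have blq: "bounded_linear q"
    by (simp add: linear_conv_bounded_linear)
  note contq = linear_continuous_on[OF blq] linear_continuous_at[OF blq]
  have contj: "continuous_on UNIV j"
  proof -
    have "j u = u $ 1 *\<^sub>R axis 1 1 + u $ 2 *\<^sub>R axis 2 1 + axis 3 1" for u
      by (simp add: j_def vec_eq_iff forall_3 axis_def)
    then have "j = (\<lambda>u. u $ 1 *\<^sub>R axis 1 1 + u $ 2 *\<^sub>R axis 2 1 + axis 3 1)"
      by blast
    then show ?thesis
      by (auto intro!: continuous_intros)
  qed
  have dg: "(g has_derivative frechet_derivative g (at u)) (at u)" if "u \<in> \<Omega>" for u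
    using smooth_on_imp_C1(1)[OF g that] by (simp add: frechet_derivative_works[symmetric])
  note ling = has_derivative_linear[OF dg]
  have ind: "\<forall>r s t. r *\<^sub>R frechet_derivative g (at u) (axis 1 1) + s *\<^sub>R frechet_derivative g (at u) (axis 2 1) +
      t *\<^sub>R g u = 0 \<longrightarrow> r = 0 \<and> s = 0 \<and> t = 0" if "u \<in> \<Omega>" for u
    using nz[OF that] unfolding area_density_eq_det3 det3_nonzero_iff_independent by simp
  define H where "H = (\<lambda>w. w $ 3 *\<^sub>R g (q w))"
  define DH where "DH = (\<lambda>w k. w $ 3 *\<^sub>R frechet_derivative g (at (q w)) (q k) + k $ 3 *\<^sub>R g (q w))"
  define S where "S = q -` \<Omega>"
  have S: "open S"
    unfolding S_def using \<open>open \<Omega>\<close> contq(2) by (intro continuous_open_vimage) auto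
  have HD: "(H has_derivative DH w) (at w)" if "w \<in> S" for w
  proof -
    have "((\<lambda>w. g (q w)) has_derivative (\<lambda>k. frechet_derivative g (at (q w)) (q k))) (at w)"
      using that by (intro has_derivative_compose[OF bounded_linear_imp_has_derivative[OF blq] dg])
        (simp add: S_def)
    then have "((\<lambda>w. w $ 3 *\<^sub>R g (q w)) has_derivative
        (\<lambda>k. w $ 3 *\<^sub>R frechet_derivative g (at (q w)) (q k) + k $ 3 *\<^sub>R g (q w))) (at w)"
      by (intro has_derivative_scaleR bounded_linear_imp_has_derivative bounded_linear_vec_nth)
    then show ?thesis
      by (simp add: H_def DH_def)
  qed
  have blD: "bounded_linear (DH w)" if "w \<in> S" for w
    using HD[OF that] by (rule has_derivative_bounded_linear)
  \<comment> \<open>The derivative is bundled as an operator because the inverse function theorem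
    asks for its continuity in operator norm; in finite dimension this can be checked vector by
    vector.\<close>
  define D where "D = (\<lambda>w. Blinfun (DH w))"
  have D: "blinfun_apply (D w) = DH w" if "w \<in> S" for w
    by (simp add: D_def bounded_linear_Blinfun_apply[OF blD[OF that]])
  have contD: "continuous_on S D"
  proof (rule continuous_on_blinfun_componentwise)
    fix i :: "real^3"
    have "continuous_on S (\<lambda>w. frechet_derivative g (at (q w)) (q i))" "continuous_on S (\<lambda>w. g (q w))"
      by (rule continuous_on_compose2[OF smooth_on_imp_C1(2)[OF g] contq(1)]
          continuous_on_compose2[OF smooth_on_imp_C1(3)[OF g] contq(1)], auto simp: S_def)+
    then have "continuous_on S (\<lambda>w. DH w i)"
      unfolding DH_def by (intro continuous_intros)
    then show "continuous_on S (\<lambda>w. blinfun_apply (D w) i)"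
      by (rule continuous_on_eq) (simp add: D)
  qed
  have j0: "j u0 \<in> S"
    using \<open>u0 \<in> \<Omega>\<close> by (simp add: S_def)
  \<comment> \<open>At height 1 the derivative combines the two partial derivatives of
    \<open>g\<close> and \<open>g\<close> itself with the coordinates of \<open>k\<close> as
    coefficients, and these three vectors are independent.\<close>
  have "inj (DH (j u0))"
    unfolding linear_injective_0[OF bounded_linear.linear[OF blD[OF j0]]]
  proof (intro allI impI)
    fix k assume "DH (j u0) k = 0"
    then have "k $ 1 *\<^sub>R frechet_derivative g (at u0) (axis 1 1) +
        k $ 2 *\<^sub>R frechet_derivative g (at u0) (axis 2 1) + k $ 3 *\<^sub>R g u0 = 0"
      using linear_real2[OF ling[OF \<open>u0 \<in> \<Omega>\<close>], of "q k"] by (simp add: DH_def)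
    then have "k $ 1 = 0 \<and> k $ 2 = 0 \<and> k $ 3 = 0"
      by (rule ind[OF \<open>u0 \<in> \<Omega>\<close>, rule_format])
    then show "k = 0"
      by (simp add: vec_eq_iff forall_3)
  qed
  then obtain L where L: "linear L" "L \<circ> DH (j u0) = id"
    using linear_injective_left_inverse[OF bounded_linear.linear[OF blD[OF j0]]] by blast
  have inv: "Blinfun L o\<^sub>L D (j u0) = id_blinfun"
    using L by (intro blinfun_eqI)
      (simp add: D[OF j0] bounded_linear_Blinfun_apply linear_conv_bounded_linear pointfree_idE)
  have HD': "(H has_derivative blinfun_apply (D w)) (at w)" if "w \<in> S" for w
    using HD[OF that] D[OF that] by simp
  obtain U' V \<psi> \<psi>' where "open U'" "U' \<subseteq> S" "j u0 \<in> U'" "open V" "H (j u0) \<in> V"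
    and hom: "homeomorphism U' V H \<psi>" and \<psi>': "\<And>v. v \<in> V \<Longrightarrow> (\<psi> has_derivative \<psi>' v) (at v)"
    by (rule inverse_function_theorem[OF S HD' contD j0 inv]) (assumption, rule that)
  define \<Omega>' where "\<Omega>' = j -` U'"
  have "open \<Omega>'"
    unfolding \<Omega>'_def using contj \<open>open U'\<close> by (intro open_vimage)
  have sub: "\<Omega>' \<subseteq> \<Omega>"
    using \<open>U' \<subseteq> S\<close> by (auto simp: \<Omega>'_def S_def)
  have Hj: "H (j u) = g u" for u
    by (simp add: H_def)
  have gV: "g u \<in> V" "\<psi> (g u) = j u" "q (\<psi> (g u)) = u" if "u \<in> \<Omega>'" for u
  proof -
    have "j u \<in> U'"
      using that by (simp add: \<Omega>'_def)
    then show "g u \<in> V" "\<psi> (g u) = j u"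
      using homeomorphism_image1[OF hom] homeomorphism_apply1[OF hom] Hj[of u] by (metis imageI)+
    then show "q (\<psi> (g u)) = u"
      by simp
  qed
  note cont\<psi> = homeomorphism_cont2[OF hom]
  \<comment> \<open>A unit vector in \<open>V\<close> has scale 1 or -1 under \<open>\<psi>\<close>,
    since the norm is even. Positivity leaves only scale 1, that is, points of the image of
    \<open>g\<close>.\<close>
  define V' where "V' = {v \<in> V. \<psi> v $ 3 > 0}"
  have "open V'"
  proof -
    have "open (V \<inter> \<psi> -` {w. w $ 3 > 0})"
      by (intro continuous_open_preimage cont\<psi> \<open>open V\<close> open_halfspace_component_gt_cart)
    then show ?thesis
      by (simp add: V'_def vimage_def Int_def)
  qed
  have im: "g ` \<Omega>' = unit_sphere N \<inter> V'"
  proof (intro equalityI subsetI)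
    fix v assume "v \<in> g ` \<Omega>'"
    then show "v \<in> unit_sphere N \<inter> V'"
      using sphere sub gV by (auto simp: V'_def unit_sphere_def)
  next
    fix v assume v: "v \<in> unit_sphere N \<inter> V'"
    define w where "w = \<psi> v"
    have w: "w \<in> U'" "H w = v" "w $ 3 > 0"
      using v homeomorphism_image2[OF hom] homeomorphism_apply2[OF hom] by (auto simp: V'_def w_def)
    have "q w \<in> \<Omega>"
      using w(1) \<open>U' \<subseteq> S\<close> by (auto simp: S_def)
    have "N v = w $ 3 * N (g (q w))"
      using N w(2,3) by (auto simp: is_norm_def H_def)
    then have "w $ 3 = 1"
      using v sphere[OF \<open>q w \<in> \<Omega>\<close>] by (simp add: unit_sphere_def)
    then have "j (q w) = w"
      by (simp add: j_def q_def vec_eq_iff forall_3)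
    then have "q w \<in> \<Omega>'" "g (q w) = v"
      using w(1,2) Hj[of "q w"] by (simp_all add: \<Omega>'_def)
    then show "v \<in> g ` \<Omega>'"
      by blast
  qed
  have reg: "(\<Omega>', g) \<in> regular_params (unit_sphere N)"
    unfolding regular_params_def
  proof (clarsimp, intro conjI ballI)
    show "open \<Omega>'" "smooth_on g \<Omega>'"
      using \<open>open \<Omega>'\<close> smooth_on_subset[OF g sub] by auto
    show "inj (frechet_derivative g (at u))" if "u \<in> \<Omega>'" for u
    proof -
      have u: "u \<in> \<Omega>"
        using sub that by blast
      show ?thesis
        unfolding linear_injective_0[OF ling[OF u]]
      proof (intro allI impI)
        fix h assume "frechet_derivative g (at u) h = 0"
        then have "h $ 1 *\<^sub>R frechet_derivative g (at u) (axis 1 1) +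
            h $ 2 *\<^sub>R frechet_derivative g (at u) (axis 2 1) + 0 *\<^sub>R g u = 0"
          using linear_real2[OF ling[OF u], of h] by simp
        then have "h $ 1 = 0 \<and> h $ 2 = 0"
          using ind[OF u] by blast
        then show "h = 0"
          by (simp add: vec_eq_iff forall_2)
      qed
    qed
    show "openin (top_of_set (unit_sphere N)) (g ` \<Omega>')"
      unfolding im using \<open>open V'\<close> by (rule openin_open_Int)
    have "homeomorphic_maps (top_of_set \<Omega>') (top_of_set (g ` \<Omega>')) g (q \<circ> \<psi>)"
      unfolding homeomorphic_maps_def
    proof (intro conjI ballI)
      show "continuous_map (top_of_set \<Omega>') (top_of_set (g ` \<Omega>')) g"
        using continuous_on_subset[OF smooth_on_imp_C1(3)[OF g] sub] by auto
      have "continuous_on (g ` \<Omega>') (q \<circ> \<psi>)"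
        using gV(1) by (intro continuous_on_compose contq(1) continuous_on_subset[OF cont\<psi>]) auto
      then show "continuous_map (top_of_set (g ` \<Omega>')) (top_of_set \<Omega>') (q \<circ> \<psi>)"
        using gV(3) by auto
    qed (use gV(3) in auto)
    then have "homeomorphic_map (top_of_set \<Omega>') (top_of_set (g ` \<Omega>')) g"
      unfolding homeomorphic_map_maps by blast
    then show "embedding_map (top_of_set \<Omega>') (top_of_set (unit_sphere N)) g"
      using im by (simp add: embedding_map_def subtopology_subtopology Int_absorb1)
  qed
  have "transition (\<Omega>\<^sub>1, y) (\<Omega>', g) differentiable (at u)"
    if y: "(\<Omega>\<^sub>1, y) \<in> regular_params (unit_sphere N)" and u: "u \<in> overlap (\<Omega>\<^sub>1, y) (\<Omega>', g)" for \<Omega>\<^sub>1 y u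
  proof -
    note y' = regular_param[OF y]
    have op: "open (overlap (\<Omega>\<^sub>1, y) (\<Omega>', g))"
      using open_vimage_param[OF y'(1,3) regular_param(5)[OF reg]] by (simp add: overlap_def)
    \<comment> \<open>The transition map is written through the local inverse of the cone, which is
      differentiable on an open set of three-space, so the chain rule applies.\<close>
    have eq: "q (\<psi> (y v)) = transition (\<Omega>\<^sub>1, y) (\<Omega>', g) v" if "v \<in> overlap (\<Omega>\<^sub>1, y) (\<Omega>', g)" for v
      using transition_right[OF that] gV(3) by metis
    have "u \<in> \<Omega>\<^sub>1" "y u \<in> V"
      using u gV(1) by (auto simp: overlap_def)
    have "(y has_derivative frechet_derivative y (at u)) (at u)"
      using smooth_on_imp_C1(1)[OF y'(2) \<open>u \<in> \<Omega>\<^sub>1\<close>] by (simp add: frechet_derivative_works[symmetric])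
    then have "((\<lambda>u. \<psi> (y u)) has_derivative (\<lambda>k. \<psi>' (y u) (frechet_derivative y (at u) k))) (at u)"
      using \<psi>'[OF \<open>y u \<in> V\<close>] by (rule has_derivative_compose)
    then have "((\<lambda>u. q (\<psi> (y u))) has_derivative (\<lambda>k. q (\<psi>' (y u) (frechet_derivative y (at u) k)))) (at u)"
      by (rule bounded_linear.has_derivative[OF blq])
    from has_derivative_transform_within_open[OF this op u eq] show ?thesis
      by (rule differentiableI)
  qed
  moreover have "u0 \<in> \<Omega>'"
    using \<open>j u0 \<in> U'\<close> by (simp add: \<Omega>'_def)
  ultimately show ?thesis
    by (intro that[OF _ sub reg])
qed

section \<open>Quotients of areas\<close>

text \<open>The estimate is the integral of \<open>(c - \<delta>) \<bar>d\<bar> \<le> \<bar>e\<bar>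
  \<le> (c + \<delta>) \<bar>d\<bar>\<close>. Boundedness of \<open>E\<close> and of
  \<open>d\<close> makes both integrals finite, and \<open>d\<close> being nonzero on a nonempty
  open set makes the denominator positive, so neither \<open>enn2real\<close> of infinity nor
  division by zero interferes.\<close>

lemma quotient_of_integrals_bound:
  fixes d e :: "real^2 \<Rightarrow> real"
  assumes E: "open E" "E \<noteq> {}" "bounded E" and cont: "continuous_on E d" "continuous_on E e"
    and d: "\<And>u. u \<in> E \<Longrightarrow> d u \<noteq> 0" "\<And>u. u \<in> E \<Longrightarrow> \<bar>d u\<bar> \<le> B"
    and e: "\<And>u. u \<in> E \<Longrightarrow> \<bar>\<bar>e u\<bar> - c * \<bar>d u\<bar>\<bar> \<le> \<delta> * \<bar>d u\<bar>"
    and "0 \<le> c" "0 \<le> \<delta>"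
  shows "\<bar>enn2real (\<integral>\<^sup>+u\<in>E. ennreal \<bar>e u\<bar> \<partial>lborel) / enn2real (\<integral>\<^sup>+u\<in>E. ennreal \<bar>d u\<bar> \<partial>lborel) - c\<bar> \<le> \<delta>"
proof -
  let ?d = "\<lambda>u. ennreal \<bar>indicator E u * d u\<bar>" and ?e = "\<lambda>u. ennreal \<bar>indicator E u * e u\<bar>"
  have "E \<in> sets borel"
    using E(1) by simp
  then have [measurable]: "(\<lambda>u. indicator E u * d u) \<in> borel_measurable borel"
    "(\<lambda>u. indicator E u * e u) \<in> borel_measurable borel"
    using borel_measurable_continuous_on_indicator[OF _ cont(1)]
      borel_measurable_continuous_on_indicator[OF _ cont(2)] by simp_all
  define I where "I = (\<integral>\<^sup>+u. ?d u \<partial>lborel)"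
  define J where "J = (\<integral>\<^sup>+u. ?e u \<partial>lborel)"
  have I: "(\<integral>\<^sup>+u\<in>E. ennreal \<bar>d u\<bar> \<partial>lborel) = I" and J: "(\<integral>\<^sup>+u\<in>E. ennreal \<bar>e u\<bar> \<partial>lborel) = J"
    unfolding I_def J_def by (auto intro!: nn_integral_cong split: split_indicator)
  have "I \<le> (\<integral>\<^sup>+u. ennreal B * indicator E u \<partial>lborel)"
    unfolding I_def using d(2) by (intro nn_integral_mono) (auto split: split_indicator intro: ennreal_leI)
  also have "\<dots> < \<infinity>"
    using \<open>E \<in> sets borel\<close> emeasure_bounded_finite[OF E(3)]
    by (simp add: nn_integral_cmult_indicator ennreal_mult_less_top)
  finally obtain i where i: "I = ennreal i" "0 \<le> i"
    by (cases I) auto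
  have "i \<noteq> 0"
  proof
    assume "i = 0"
    then have "(\<integral>\<^sup>+u. ?d u \<partial>lborel) = 0"
      using i I_def by simp
    then have "AE u in lborel. ?d u = 0"
      by (subst (asm) nn_integral_0_iff_AE) auto
    then have "AE u in lborel. u \<notin> E"
      using d(1) by (auto elim!: eventually_mono split: split_indicator_asm)
    then have "E \<in> null_sets lborel"
      using \<open>E \<in> sets borel\<close> by (simp add: AE_iff_null_sets)
    then show False
      using open_not_negligible[OF E(1,2)] by (simp add: negligible_iff_null_sets null_sets_completionI)
  qed
  have "J \<le> (\<integral>\<^sup>+u. ennreal (c + \<delta>) * ?d u \<partial>lborel)"
    unfolding J_def
  proof (rule nn_integral_mono)
    fix u
    have "?e u \<le> ennreal ((c + \<delta>) * \<bar>indicator E u * d u\<bar>)"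
      using e[of u] by (intro ennreal_leI) (auto simp: algebra_simps abs_le_iff split: split_indicator)
    then show "?e u \<le> ennreal (c + \<delta>) * ?d u"
      using assms(9,10) by (simp add: ennreal_mult)
  qed
  also have "\<dots> = ennreal ((c + \<delta>) * i)"
    using i assms(9,10) by (simp add: nn_integral_cmult I_def[symmetric] ennreal_mult del: ennreal_plus)
  finally have J_le: "J \<le> ennreal ((c + \<delta>) * i)" .
  then have "J < \<infinity>"
    by (rule le_less_trans) simp
  then obtain k where k: "J = ennreal k" "0 \<le> k"
    by (cases J) auto
  \<comment> \<open>The lower estimate is kept in additive form, since \<open>c - \<delta>\<close>
    may be negative while the integrals take values in \<open>ennreal\<close>.\<close>
  have "ennreal (c * i) = (\<integral>\<^sup>+u. ennreal c * ?d u \<partial>lborel)"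
    using i assms(9) by (simp add: nn_integral_cmult I_def[symmetric] ennreal_mult)
  also have "\<dots> \<le> (\<integral>\<^sup>+u. ?e u + ennreal \<delta> * ?d u \<partial>lborel)"
  proof (rule nn_integral_mono)
    fix u
    have "ennreal (c * \<bar>indicator E u * d u\<bar>) \<le>
        ennreal (\<bar>indicator E u * e u\<bar> + \<delta> * \<bar>indicator E u * d u\<bar>)"
      using e[of u] by (intro ennreal_leI) (auto simp: algebra_simps abs_le_iff split: split_indicator)
    then show "ennreal c * ?d u \<le> ?e u + ennreal \<delta> * ?d u"
      using assms(9,10) by (simp add: ennreal_mult)
  qed
  also have "\<dots> = ennreal (k + \<delta> * i)"
    using i k assms(10)
    by (simp add: nn_integral_add nn_integral_cmult I_def[symmetric] J_def[symmetric] ennreal_mult)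
  finally have "c * i \<le> k + \<delta> * i"
    using k(2) i(2) assms(10) by (subst (asm) ennreal_le_iff) auto
  moreover have "k \<le> (c + \<delta>) * i"
    using J_le[unfolded k(1)] i(2) assms(9,10) by (subst (asm) ennreal_le_iff) auto
  moreover have "0 < i"
    using i(2) \<open>i \<noteq> 0\<close> by simp
  ultimately have "k / i \<le> c + \<delta>" "c - \<delta> \<le> k / i"
    by (simp_all add: divide_le_eq le_divide_eq left_diff_distrib)
  then have "\<bar>k / i - c\<bar> \<le> \<delta>"
    by linarith
  then show ?thesis
    unfolding I J using i k by simp
qed

lemma smooth_surface_area_param:
  assumes X: "smooth_surface X A" and sm: "smooth_map A f" "smooth_map A \<eta>" and x: "(\<Omega>, x) \<in> A"
    and E: "E \<subseteq> \<Omega>" "E \<in> sets borel"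
  shows "surface_area A f \<eta> (x ` E) = enn2real (\<integral>\<^sup>+u\<in>E. ennreal \<bar>area_density f \<eta> x u\<bar> \<partial>lborel)"
proof (rule surface_area_param[OF _ _ x smooth_surface_param(1)[OF X x] E])
  show "continuous_on \<Omega>' (area_density f \<eta> y) \<and> inj_on y \<Omega>'" if "(\<Omega>', y) \<in> A" for \<Omega>' y
    using continuous_on_area_density[OF smooth_map_param[OF sm(1) that]
        smooth_on_imp_C1(3)[OF smooth_map_param[OF sm(2) that]]]
      smooth_surface_param(2)[OF X that] by simp
next
  fix \<Omega>' y u
  assume y: "(\<Omega>', y) \<in> A" and u: "u \<in> overlap (\<Omega>', y) (\<Omega>, x)"
  let ?\<tau> = "transition (\<Omega>', y) (\<Omega>, x)"
  have "area_density f \<eta> y u = det (matrix (frechet_derivative ?\<tau> (at u))) * area_density f \<eta> x (?\<tau> u)"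
  proof (rule area_density_reparam[OF smooth_surface_overlap(1)[OF X x y] u])
    show "y v = x (?\<tau> v)" if "v \<in> overlap (\<Omega>', y) (\<Omega>, x)" for v
      using transition_right(2)[OF that] by simp
    show "f \<circ> x differentiable at (?\<tau> u)"
      using smooth_on_imp_C1(1)[OF smooth_map_param[OF sm(1) x] transition_right(1)[OF u]] .
  qed (rule smooth_surface_overlap(2)[OF X x y u])
  then show "?\<tau> differentiable at u \<and>
      area_density f \<eta> y u = det (matrix (frechet_derivative ?\<tau> (at u))) * area_density f \<eta> x (?\<tau> u)"
    using smooth_surface_overlap(2)[OF X x y u] by blast
qed

text \<open>Differentiability of the transition maps is a hypothesis here, as membership in
  \<open>regular_params\<close> does not state it; for the chart \<eta> \<circ> x it comes from the
  cone construction.\<close>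

lemma regular_params_surface_area:
  assumes x: "(\<Omega>, x) \<in> regular_params S"
    and diff: "\<And>\<Omega>' y u. (\<Omega>', y) \<in> regular_params S \<Longrightarrow> u \<in> overlap (\<Omega>', y) (\<Omega>, x) \<Longrightarrow>
      transition (\<Omega>', y) (\<Omega>, x) differentiable (at u)"
    and E: "E \<subseteq> \<Omega>" "E \<in> sets borel"
  shows "surface_area (regular_params S) id id (x ` E) =
    enn2real (\<integral>\<^sup>+u\<in>E. ennreal \<bar>area_density id id x u\<bar> \<partial>lborel)"
proof (rule surface_area_param[OF _ _ x regular_param(1)[OF x] E])
  show "continuous_on \<Omega>' (area_density id id y) \<and> inj_on y \<Omega>'" if "(\<Omega>', y) \<in> regular_params S" for \<Omega>' y
    using regular_param(2,4)[OF that] smooth_on_imp_C1(3)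
    by (auto intro!: continuous_on_area_density)
next
  fix \<Omega>' y u
  assume y: "(\<Omega>', y) \<in> regular_params S" and u: "u \<in> overlap (\<Omega>', y) (\<Omega>, x)"
  let ?\<tau> = "transition (\<Omega>', y) (\<Omega>, x)"
  have op: "open (overlap (\<Omega>', y) (\<Omega>, x))"
    using open_vimage_param[OF regular_param(1,3)[OF y] regular_param(5)[OF x]]
    by (simp add: overlap_def)
  have "area_density id id y u = det (matrix (frechet_derivative ?\<tau> (at u))) * area_density id id x (?\<tau> u)"
  proof (rule area_density_reparam[OF op u])
    show "y v = x (?\<tau> v)" if "v \<in> overlap (\<Omega>', y) (\<Omega>, x)" for v
      using transition_right(2)[OF that] by simp
    show "id \<circ> x differentiable at (?\<tau> u)"
      using smooth_on_imp_C1(1)[OF regular_param(2)[OF x] transition_right(1)[OF u]] by simp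
  qed (rule diff[OF y u])
  then show "?\<tau> differentiable at u \<and>
      area_density id id y u = det (matrix (frechet_derivative ?\<tau> (at u))) * area_density id id x (?\<tau> u)"
    using diff[OF y u] by blast
qed

theorem theorem2p1:
  fixes N :: "real^3 \<Rightarrow> real"
    and M :: "'a topology" and A :: "'a param set"
    and f \<eta> :: "'a \<Rightarrow> real^3"
    and K :: "'a \<Rightarrow> real"
    and p :: 'a and U :: "'a set"
  assumes "is_norm N" and "smooth_norm N" and "strictly_convex_norm N"
    and "nowhere_zero_gauss_curvature (unit_sphere N)"
    and "orientable_surface M A" and "immersion A f"
    and "birkhoff_gauss_map N M A f \<eta>"
    and K_def: "K = normal_map_curvature A f \<eta>"
    and "p \<in> topspace M" and "K p \<noteq> 0"
    and "neighborhood_of M p U" and "connectedin M U"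
    and "\<forall>q\<in>U. sgn (K q) = sgn (K p)"
  shows "\<forall>\<epsilon>>0. \<exists>W\<subseteq>U. neighborhood_of M p W \<and>
           (\<forall>D. openin M D \<and> p \<in> D \<and> D \<subseteq> W \<longrightarrow>
              \<bar>signed_image_area N A f \<eta> D / surface_area A f \<eta> D - K p\<bar> < \<epsilon>)"
proof (intro allI impI)
  fix \<epsilon> :: real
  assume "0 < \<epsilon>"
  have M: "smooth_surface M A"
    using assms(5) by (simp add: orientable_surface_def)
  have sm: "smooth_map A f" "smooth_map A \<eta>"
    using assms(6,7) by (auto simp: immersion_def birkhoff_gauss_map_def)
  have "p \<in> (\<Union>(\<Omega>, x)\<in>A. x ` \<Omega>)"
    using M assms(9) by (simp add: smooth_surface_def)
  then obtain \<Omega> x u0 where x: "(\<Omega>, x) \<in> A" and u0: "u0 \<in> \<Omega>" "x u0 = p"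
    by auto
  obtain V where V: "openin M V" "p \<in> V" "V \<subseteq> U"
    using assms(11) by (auto simp: neighborhood_of_def)
  define d where "d = area_density f \<eta> x"
  define e where "e = area_density \<eta> \<eta> x"
  note x' = smooth_surface_param[OF M x]
  have d_nz: "d u \<noteq> 0" and K_eq: "K (x u) = e u / d u" if "u \<in> \<Omega>" for u
    using birkhoff_gauss_map_param[OF assms(1,2) M assms(6,7) x that]
      normal_map_curvature_param[OF M assms(6) sm(2) x that]
    by (auto simp: K_def d_def e_def)
  have cont: "continuous_on \<Omega> d" "continuous_on \<Omega> e"
    unfolding d_def e_def
    by (intro continuous_on_area_density smooth_on_imp_C1(3) smooth_map_param[OF _ x] sm)+
  define \<Omega>1 where "\<Omega>1 = {u \<in> \<Omega>. x u \<in> V}"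
  have "open \<Omega>1" "u0 \<in> \<Omega>1" "\<Omega>1 \<subseteq> \<Omega>"
    using open_vimage_param[OF x'(1,3) V(1)] u0 V(2) by (auto simp: \<Omega>1_def)
  \<comment> \<open>One continuous function carries three conditions: the curvature stays within
    \<epsilon> / 2 of its value at p, \<open>d\<close> is bounded, and the parameter domain is
    bounded. The last two make the areas finite; the factor 1 / 2 turns the final non-strict bound
    into a strict one.\<close>
  define h where "h = (\<lambda>u. max (max (\<bar>e u / d u - K p\<bar> / (\<epsilon> / 2)) \<bar>d u - d u0\<bar>) (dist u u0))"
  define \<Omega>2 where "\<Omega>2 = {u \<in> \<Omega>1. h u < 1}"
  have "continuous_on \<Omega>1 h"
    unfolding h_def using d_nz \<open>\<Omega>1 \<subseteq> \<Omega>\<close> \<open>0 < \<epsilon>\<close>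
    by (intro continuous_intros continuous_on_subset[OF cont(1)] continuous_on_subset[OF cont(2)]) auto
  then have "open (\<Omega>1 \<inter> h -` {..<1})"
    using \<open>open \<Omega>1\<close> by (intro continuous_open_preimage) auto
  then have "open \<Omega>2"
    by (simp add: \<Omega>2_def vimage_def Int_def)
  have "u0 \<in> \<Omega>2" "\<Omega>2 \<subseteq> \<Omega>"
    using \<open>u0 \<in> \<Omega>1\<close> \<open>\<Omega>1 \<subseteq> \<Omega>\<close> K_eq[OF u0(1)] u0(2) by (auto simp: \<Omega>2_def h_def)
  have near: "\<bar>e u / d u - K p\<bar> \<le> \<epsilon> / 2" "\<bar>d u\<bar> \<le> \<bar>d u0\<bar> + 1" "u \<in> ball u0 1" "x u \<in> U" "K (x u) \<noteq> 0"
    if "u \<in> \<Omega>2" for u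
  proof -
    have h: "\<bar>e u / d u - K p\<bar> / (\<epsilon> / 2) < 1" "\<bar>d u - d u0\<bar> < 1" "dist u u0 < 1" "x u \<in> V"
      using that by (auto simp: \<Omega>2_def \<Omega>1_def h_def)
    show "\<bar>e u / d u - K p\<bar> \<le> \<epsilon> / 2"
      using h(1) \<open>0 < \<epsilon>\<close> by (simp add: field_simps)
    show "\<bar>d u\<bar> \<le> \<bar>d u0\<bar> + 1" "u \<in> ball u0 1"
      using h(2,3) by (auto simp: dist_commute)
    show "x u \<in> U"
      using h(4) V(3) by blast
    then show "K (x u) \<noteq> 0"
      using assms(13) \<open>K p \<noteq> 0\<close> by (metis sgn_0_0)
  qed
  define g where "g = \<eta> \<circ> x"
  \<comment> \<open>On the sphere the normal at a point is the point itself, so its density in the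
    chart \<open>g\<close> is \<open>e\<close>. This is nonzero where \<open>K\<close> is, as the
    cone construction requires.\<close>
  have e_eq: "area_density id id g = e"
    by (simp add: area_density_def e_def g_def fun_eq_iff)
  obtain \<Omega>3 where "u0 \<in> \<Omega>3" "\<Omega>3 \<subseteq> \<Omega>2" and reg: "(\<Omega>3, g) \<in> regular_params (unit_sphere N)"
    and trans: "\<And>\<Omega>' y u. (\<Omega>', y) \<in> regular_params (unit_sphere N) \<Longrightarrow> u \<in> overlap (\<Omega>', y) (\<Omega>3, g) \<Longrightarrow>
      transition (\<Omega>', y) (\<Omega>3, g) differentiable (at u)"
  proof (rule unit_sphere_param[OF assms(1) _ \<open>open \<Omega>2\<close> \<open>u0 \<in> \<Omega>2\<close>])
    show "smooth_on g \<Omega>2"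
      unfolding g_def by (rule smooth_on_subset[OF smooth_map_param[OF sm(2) x] \<open>\<Omega>2 \<subseteq> \<Omega>\<close>])
    show "N (g u) = 1" if "u \<in> \<Omega>2" for u
      using assms(7) x'(6) that \<open>\<Omega>2 \<subseteq> \<Omega>\<close>
      by (auto simp: birkhoff_gauss_map_def unit_sphere_def g_def)
    show "area_density id id g u \<noteq> 0" if "u \<in> \<Omega>2" for u
      using near(5)[OF that] K_eq that \<open>\<Omega>2 \<subseteq> \<Omega>\<close> by (auto simp: e_eq)
  qed (use that in blast)
  have "open \<Omega>3" "\<Omega>3 \<subseteq> \<Omega>"
    using regular_param(1)[OF reg] \<open>\<Omega>3 \<subseteq> \<Omega>2\<close> \<open>\<Omega>2 \<subseteq> \<Omega>\<close> by auto
  have "openin (subtopology M (x ` \<Omega>)) (x ` \<Omega>3)"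
    using x'(4) \<open>open \<Omega>3\<close> \<open>\<Omega>3 \<subseteq> \<Omega>\<close>
      homeomorphic_map_openness[of "top_of_set \<Omega>" "subtopology M (x ` \<Omega>)" x \<Omega>3]
    by (simp add: embedding_map_def open_subset)
  then have W: "openin M (x ` \<Omega>3)"
    using x'(5) by (metis openin_trans_full)
  show "\<exists>W\<subseteq>U. neighborhood_of M p W \<and>
           (\<forall>D. openin M D \<and> p \<in> D \<and> D \<subseteq> W \<longrightarrow>
              \<bar>signed_image_area N A f \<eta> D / surface_area A f \<eta> D - K p\<bar> < \<epsilon>)"
  proof (intro exI[of _ "x ` \<Omega>3"] conjI allI impI)
    show "x ` \<Omega>3 \<subseteq> U"
      using near(4) \<open>\<Omega>3 \<subseteq> \<Omega>2\<close> by auto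
    then have sgnK: "sgn (K q) = sgn (K p)" if "q \<in> x ` \<Omega>3" for q
      using assms(13) that by blast
    show "neighborhood_of M p (x ` \<Omega>3)"
      unfolding neighborhood_of_def using W openin_subset[OF W] \<open>u0 \<in> \<Omega>3\<close> u0(2) by blast
    fix D assume D: "openin M D \<and> p \<in> D \<and> D \<subseteq> x ` \<Omega>3"
    define E where "E = {u \<in> \<Omega>3. x u \<in> D}"
    have "E = \<Omega>3 \<inter> {u \<in> \<Omega>. x u \<in> D}"
      using \<open>\<Omega>3 \<subseteq> \<Omega>\<close> by (auto simp: E_def)
    then have "open E"
      using open_vimage_param[OF x'(1,3)] D \<open>open \<Omega>3\<close> by auto
    have E: "E \<subseteq> \<Omega>3" "E \<subseteq> \<Omega>2" "E \<subseteq> \<Omega>" "E \<in> sets borel" "E \<noteq> {}"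
      using \<open>open E\<close> \<open>\<Omega>3 \<subseteq> \<Omega>2\<close> \<open>\<Omega>3 \<subseteq> \<Omega>\<close> D \<open>u0 \<in> \<Omega>3\<close> u0(2) by (auto simp: E_def)
    have "x ` E = D"
      using D by (auto simp: E_def)
    define I where "I = enn2real (\<integral>\<^sup>+u\<in>E. ennreal \<bar>d u\<bar> \<partial>lborel)"
    define J where "J = enn2real (\<integral>\<^sup>+u\<in>E. ennreal \<bar>e u\<bar> \<partial>lborel)"
    have I: "surface_area A f \<eta> D = I"
      using smooth_surface_area_param[OF M sm x E(3,4)] \<open>x ` E = D\<close> by (simp add: I_def d_def)
    have "\<eta> ` D = g ` E"
      using \<open>x ` E = D\<close> by (auto simp: g_def)
    then have J: "sphere_area N (\<eta> ` D) = J"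
      using regular_params_surface_area[OF reg trans E(1,4)] by (simp add: sphere_area_def e_eq J_def)
    have "\<bar>J / I - \<bar>K p\<bar>\<bar> \<le> \<epsilon> / 2"
      unfolding I_def J_def
    proof (rule quotient_of_integrals_bound[OF \<open>open E\<close> E(5)])
      show "bounded E"
        using near(3) E(2) by (intro bounded_subset[OF bounded_ball[of u0 1]]) auto
      show "continuous_on E d" "continuous_on E e"
        using cont E(3) by (auto intro: continuous_on_subset)
      show "d u \<noteq> 0" "\<bar>d u\<bar> \<le> \<bar>d u0\<bar> + 1" if "u \<in> E" for u
        using that E(2,3) d_nz near(2) by auto
      show "\<bar>\<bar>e u\<bar> - \<bar>K p\<bar> * \<bar>d u\<bar>\<bar> \<le> \<epsilon> / 2 * \<bar>d u\<bar>" if "u \<in> E" for u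
      proof -
        have "d u \<noteq> 0"
          using that E(3) d_nz by blast
        then have "\<bar>e u\<bar> - \<bar>K p\<bar> * \<bar>d u\<bar> = (\<bar>e u / d u\<bar> - \<bar>K p\<bar>) * \<bar>d u\<bar>"
          by (simp add: algebra_simps)
        \<comment> \<open>The reverse triangle inequality passes from absolute values of the
          curvature to the curvature itself.\<close>
        also have "\<bar>\<dots>\<bar> \<le> \<bar>e u / d u - K p\<bar> * \<bar>d u\<bar>"
          unfolding abs_mult abs_abs by (intro mult_right_mono abs_triangle_ineq3) simp
        also have "\<dots> \<le> \<epsilon> / 2 * \<bar>d u\<bar>"
          using near(1) that E(2) by (intro mult_right_mono) auto
        finally show ?thesis .
      qed
    qed (use \<open>0 < \<epsilon>\<close> in auto)
    \<comment> \<open>On \<open>D\<close> the sign of \<open>K\<close> is that of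
      \<open>K p\<close>. If \<open>K p\<close> is positive, the point p of \<open>D\<close> itself
      makes the negativity test fail.\<close>
    moreover have "signed_image_area N A f \<eta> D = sgn (K p) * J"
    proof (cases "K p < 0")
      case True
      then have "K q < 0" if "q \<in> D" for q
        using sgnK[of q] D that by (metis sgn_less subsetD)
      then show ?thesis
        using True J by (auto simp: signed_image_area_def K_def)
    next
      case False
      then show ?thesis
        using D J \<open>K p \<noteq> 0\<close> by (auto simp: signed_image_area_def K_def)
    qed
    \<comment> \<open>Multiplying both \<open>J / I\<close> and \<open>\<bar>K p\<bar>\<close> by
      the sign of \<open>K p\<close> leaves their distance unchanged.\<close>
    ultimately have "\<bar>signed_image_area N A f \<eta> D / I - K p\<bar> \<le> \<epsilon> / 2"
      using \<open>K p \<noteq> 0\<close> by (cases "K p < 0") (auto simp: abs_real_def split: if_splits)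
    then show "\<bar>signed_image_area N A f \<eta> D / surface_area A f \<eta> D - K p\<bar> < \<epsilon>"
      unfolding I using \<open>0 < \<epsilon>\<close> by linarith
  qed
qed

end
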